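(* Let $q_0$ be even. If $s\ge 3$ is odd and satisfies $$q_0^s-q_0^{s/2}\left(\frac{q_0}{2}\right)^{q_0-1}\left(2q_0^2-7q_0+3\right)>\left(\frac{q_0}{2}\right)^{q_0-1}\left(4q_0-2\right)-q_0^2,$$ then $\rho(C_s(q_0))=3$.
   Context: Let $q=q_0^s$ and $H=\{x\in\mathbb{F}_{q^2}: x^{q+1}=1\}$. The code $C_s(q_0)$ is the linear code of length $q+1$ over $\mathbb{F}_{q_0}$ with coordinates indexed by $H$: $C_s(q_0)=\{(c_x)_{x\in H}\in\mathbb{F}_{q_0}^{q+1}: \sum_{x\in H}c_x x=0\}$. $\rho(C)$ denotes the covering radius of a code $C$ (maximum over all vectors of the minimum Hamming distance to the code). *)

theory Defs
  imports Complex_Main "HOL-Library.FuncSet" "HOL-Library.Cardinality"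
    "HOL-Number_Theory.Prime_Powers"
begin

text \<open>
  Words over an alphabet \<open>A\<close> with coordinates indexed by a set \<open>I\<close> are the extensional
  functions in \<open>I \<rightarrow>\<^sub>E A\<close>, and a code is a set of such words.
\<close>

definition hamming_dist :: "'i set \<Rightarrow> ('i \<Rightarrow> 'a) \<Rightarrow> ('i \<Rightarrow> 'a) \<Rightarrow> nat" where
  "hamming_dist I u v = card {i \<in> I. u i \<noteq> v i}"

text \<open>Meaningful only for finite \<open>I\<close>, finite nonempty \<open>A\<close> and nonempty \<open>C\<close>,
  so that the minimum and the maximum exist.\<close>

definition covering_radius :: "'i set \<Rightarrow> 'a set \<Rightarrow> ('i \<Rightarrow> 'a) set \<Rightarrow> nat" where
  "covering_radius I A C =
     Max ((\<lambda>u. Min ((\<lambda>c. hamming_dist I u c) ` C)) ` (I \<rightarrow>\<^sub>E A))"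

definition is_subfield :: "'a::field set \<Rightarrow> bool" where
  "is_subfield K \<longleftrightarrow>
     0 \<in> K \<and> 1 \<in> K \<and>
     (\<forall>x\<in>K. \<forall>y\<in>K. x + y \<in> K \<and> x * y \<in> K) \<and>
     (\<forall>x\<in>K. - x \<in> K \<and> inverse x \<in> K)"

text \<open>Below, the type \<open>'a\<close> plays the role of the field with \<open>q\<^sup>2\<close> elements and
  \<open>K\<close> that of its subfield with \<open>q0\<close> elements, where \<open>q = q0 ^ s\<close>; inside the code,
  \<open>q0\<close> is recovered as \<open>card K\<close>.\<close>

definition unit_circle :: "nat \<Rightarrow> 'a::field set" where
  "unit_circle q = {x. x ^ (q + 1) = 1}"

definition zetterberg_code :: "nat \<Rightarrow> 'a::field set \<Rightarrow> ('a \<Rightarrow> 'a) set" where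
  "zetterberg_code s K =
     (let H = unit_circle (card K ^ s)
      in {c \<in> H \<rightarrow>\<^sub>E K. (\<Sum>x\<in>H. c x * x) = 0})"

end

theory Submission
  imports Defs "HOL-Computational_Algebra.Polynomial"
begin

text \<open>
  A word can be corrected to a codeword in \<open>w\<close> places iff its syndrome is a \<open>K\<close>-linear combination
  of \<open>w\<close> elements of \<open>H\<close>. Multiplying by elements of \<open>H\<close>, one may take the syndrome \<open>r\<close> in the field
  \<open>F\<close> with \<open>q\<close> elements, and a nonzero \<open>t \<in> F\<close> is of the form \<open>x + 1/x\<close> with \<open>x \<in> H\<close> iff \<open>1/t\<close> has
  absolute trace one. Comparing norms, \<open>r \<notin> K\<close> is not a combination of two elements iff
  \<open>d/(r + c\<^sub>1 + c\<^sub>2)\<close> has trace zero for all \<open>c\<^sub>1, c\<^sub>2 \<in> K\<close> and \<open>d\<^sup>2 = c\<^sub>1 c\<^sub>2\<close>. These conditions are detected by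
  the sums of \<open>\<chi> (\<Sum>\<gamma>. \<delta> \<gamma> / (r + \<gamma>))\<close> over \<open>r\<close>, which Bombieri's form of Stepanov's method bounds
  elementarily. When \<open>q\<close> is not a square that method loses a factor \<open>\<surd>2\<close> against Weil's bound; since
  both sides of the hypothesis are close to powers of two and \<open>s\<close> is odd, there is room for this loss.
\<close>

section \<open>Finite subfields\<close>

text \<open>For fixed \<gamma> = c1 + c2 the square roots of the products c1 c2 form an additive
  group: all of K if \<gamma> = 0, and a group of order q0/2 otherwise. The condition at \<gamma> is
  therefore detected by a full character sum over this group, and the product over \<gamma> expands
  into q0 (q0/2)^(q0-1) sums, one for each tuple \<delta>; this accounts for the power of q0/2 in
  the hypothesis. A tuple with w nonzero entries gives an Artin-Schreier curve with w simple poles,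
  hence of genus w - 1, so the weights of the tuples are added up rather than all bounded by q0.
  Stepanov's method bounds numbers of points only from above. This is enough: positivity of the
  total needs only lower bounds for the single sums, and adding a constant of trace one turns the
  points of trace one into points of trace zero on a twisted curve. The method works with a
  factorization q = u v into powers of two with v \<le> u, and its main error 2 (w - 1) u replaces 2
  (w - 1) sqrt q.\<close>

lemma is_subfield_zero: "is_subfield F \<Longrightarrow> 0 \<in> F"
  and is_subfield_one: "is_subfield F \<Longrightarrow> 1 \<in> F"
  and is_subfield_add: "is_subfield F \<Longrightarrow> x \<in> F \<Longrightarrow> y \<in> F \<Longrightarrow> x + y \<in> F"
  and is_subfield_mult: "is_subfield F \<Longrightarrow> x \<in> F \<Longrightarrow> y \<in> F \<Longrightarrow> x * y \<in> F"
  and is_subfield_uminus: "is_subfield F \<Longrightarrow> x \<in> F \<Longrightarrow> - x \<in> F"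
  and is_subfield_inverse: "is_subfield F \<Longrightarrow> x \<in> F \<Longrightarrow> inverse x \<in> F"
  by (simp_all add: is_subfield_def)

lemma is_subfield_diff: "is_subfield F \<Longrightarrow> x \<in> F \<Longrightarrow> y \<in> F \<Longrightarrow> x - y \<in> F"
  using is_subfield_add[of F x "- y"] by (simp add: is_subfield_uminus)

lemma is_subfield_divide: "is_subfield F \<Longrightarrow> x \<in> F \<Longrightarrow> y \<in> F \<Longrightarrow> x / y \<in> F"
  by (simp add: divide_inverse is_subfield_mult is_subfield_inverse)

lemma is_subfield_power: "is_subfield F \<Longrightarrow> x \<in> F \<Longrightarrow> x ^ n \<in> F"
  by (induction n) (simp_all add: is_subfield_one is_subfield_mult)

lemma is_subfield_sum: "is_subfield F \<Longrightarrow> (\<And>i. i \<in> I \<Longrightarrow> f i \<in> F) \<Longrightarrow> sum f I \<in> F"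
  by (induction I rule: infinite_finite_induct) (simp_all add: is_subfield_zero is_subfield_add)

lemmas is_subfield_closed =
  is_subfield_zero is_subfield_one is_subfield_add is_subfield_mult is_subfield_uminus
  is_subfield_inverse is_subfield_diff is_subfield_divide is_subfield_power is_subfield_sum

lemma subfield_power_card:
  assumes F: "is_subfield F" and fin: "finite F" and x: "x \<in> F"
  shows "x ^ card F = x"
proof (cases "x = 0")
  case True
  then show ?thesis using F fin is_subfield_zero by (auto simp: power_0_left card_gt_0_iff)
next
  case False
  have nz: "\<Prod>(F - {0}) \<noteq> 0" using fin by simp
  have "(\<Prod>y\<in>F-{0}. x * y) = x ^ (card F - 1) * \<Prod>(F-{0})"
    using is_subfield_zero[OF F] by (simp add: prod.distrib fin)
  moreover have "(\<Prod>y\<in>F-{0}. x * y) = (\<Prod>y\<in>F-{0}. y)"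
    by (rule prod.reindex_bij_witness[of _ "\<lambda>y. y / x" "\<lambda>y. x * y"])
      (use False x in \<open>auto simp: is_subfield_mult[OF F] is_subfield_divide[OF F]\<close>)
  ultimately have "x ^ (card F - 1) = 1" using nz by simp
  moreover have "card F > 0" using fin is_subfield_zero[OF F] by (auto simp: card_gt_0_iff)
  ultimately show ?thesis by (metis Suc_diff_1 mult.right_neutral power_Suc)
qed

text \<open>Fermat's identity for -1 gives (-1)^card F = -1, whereas an even exponent gives
  1.\<close>

lemma CHAR_2_of_even_subfield:
  assumes "is_subfield (F :: 'a::field set)" "finite F" "even (card F)"
  shows "CHAR('a) = 2"
proof -
  have "(- 1 :: 'a) ^ card F = - 1"
    using assms by (intro subfield_power_card) (auto intro: is_subfield_closed)
  then have "(1 :: 'a) = - 1" using assms(3) by simp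
  then have "of_nat 2 = (0 :: 'a)" by (simp add: eq_neg_iff_add_eq_0)
  then show ?thesis
    by (intro CHAR_eq_posI) (auto simp: less_2_cases_iff)
qed

text \<open>F is a subset of the ambient field and not a type. Rationality has to be tracked because
  Stepanov's unknowns must be fixed by the q-th power.\<close>

definition poly_over :: "'a::field set \<Rightarrow> 'a poly set" where
  "poly_over F = {p. \<forall>n. coeff p n \<in> F}"

context
  fixes F :: "'a::field set"
  assumes F: "is_subfield F"
begin

lemma poly_over_0: "0 \<in> poly_over F"
  and poly_over_1: "1 \<in> poly_over F"
  and poly_over_add: "p \<in> poly_over F \<Longrightarrow> r \<in> poly_over F \<Longrightarrow> p + r \<in> poly_over F"
  and poly_over_mult: "p \<in> poly_over F \<Longrightarrow> r \<in> poly_over F \<Longrightarrow> p * r \<in> poly_over F"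
  and poly_over_smult: "c \<in> F \<Longrightarrow> p \<in> poly_over F \<Longrightarrow> smult c p \<in> poly_over F"
  and poly_over_monom: "c \<in> F \<Longrightarrow> monom c n \<in> poly_over F"
  and poly_over_linear: "c \<in> F \<Longrightarrow> d \<in> F \<Longrightarrow> [:c, d:] \<in> poly_over F"
  using F
  by (auto simp: poly_over_def coeff_mult coeff_pCons split: nat.split intro!: is_subfield_closed)

lemma poly_over_sum: "(\<And>i. i \<in> I \<Longrightarrow> f i \<in> poly_over F) \<Longrightarrow> sum f I \<in> poly_over F"
  by (induction I rule: infinite_finite_induct) (auto simp: poly_over_0 poly_over_add)

lemma poly_over_prod: "(\<And>i. i \<in> I \<Longrightarrow> f i \<in> poly_over F) \<Longrightarrow> prod f I \<in> poly_over F"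
  by (induction I rule: infinite_finite_induct) (auto simp: poly_over_1 poly_over_mult)

end

section \<open>Pole orders on a hyperelliptic curve\<close>

text \<open>The coordinates (a, b) of y^n = a + b y on the curve y^2 + h y = E, found by eliminating
  y^2.\<close>

primrec y_power :: "'a::comm_ring_1 poly \<Rightarrow> 'a poly \<Rightarrow> nat \<Rightarrow> 'a poly \<times> 'a poly" where
  "y_power h E 0 = (1, 0)"
| "y_power h E (Suc n) =
     (snd (y_power h E n) * E, fst (y_power h E n) - snd (y_power h E n) * h)"

lemma poly_y_power:
  assumes "y\<^sup>2 + poly h x * y = poly E x"
  shows "poly (fst (y_power h E n)) x + poly (snd (y_power h E n)) x * y = y ^ n"
proof (induction n)
  case (Suc n)
  let ?a = "poly (fst (y_power h E n)) x" and ?b = "poly (snd (y_power h E n)) x"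
  have "y ^ Suc n = (?a + ?b * y) * y" using Suc by simp
  also have "\<dots> = ?a * y + ?b * (poly E x - poly h x * y)"
    using assms by (simp add: algebra_simps power2_eq_square flip: assms)
  finally show ?case by (simp add: algebra_simps)
qed simp

text \<open>
  If \<open>h\<close> has degree at most \<open>g\<close> and \<open>E\<close> has degree \<open>2g + 1\<close>, then \<open>x\<close> and \<open>y\<close> have poles of
  order 2 and \<open>2g + 1\<close> at the unique point at infinity. \<open>pole_coeff g a b n\<close> is the
  coefficient of \<open>a + b y\<close> at the monomial \<open>x\<^sup>i\<close> or \<open>x\<^sup>i y\<close> with a pole of order \<open>n\<close>.
\<close>
definition pole_coeff :: "nat \<Rightarrow> 'a::comm_ring_1 poly \<Rightarrow> 'a poly \<Rightarrow> nat \<Rightarrow> 'a" where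
  "pole_coeff g a b n =
     (if even n then coeff a (n div 2)
      else if n \<ge> 2 * g + 1 then coeff b ((n - (2 * g + 1)) div 2) else 0)"

lemma pole_coeff_even: "pole_coeff g a b (2 * n) = coeff a n"
  by (simp add: pole_coeff_def)

lemma pole_coeff_odd: "pole_coeff g a b (2 * n + (2 * g + 1)) = coeff b n"
  by (simp add: pole_coeff_def)

lemma pole_coeff_sum:
  "pole_coeff g (\<Sum>i\<in>I. smult (c i) (a i)) (\<Sum>i\<in>I. smult (c i) (b i)) n =
     (\<Sum>i\<in>I. c i * pole_coeff g (a i) (b i) n)"
  by (simp add: pole_coeff_def coeff_sum)

definition has_pole_order :: "nat \<Rightarrow> 'a::comm_ring_1 poly \<Rightarrow> 'a poly \<Rightarrow> nat \<Rightarrow> bool" where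
  "has_pole_order g a b n \<longleftrightarrow>
     pole_coeff g a b n \<noteq> 0 \<and> (\<forall>k>n. pole_coeff g a b k = 0)"

lemma has_pole_order_even_iff:
  "has_pole_order g a b (2 * n) \<longleftrightarrow>
     coeff a n \<noteq> 0 \<and> (\<forall>k>n. coeff a k = 0) \<and> (\<forall>k. k + g \<ge> n \<longrightarrow> coeff b k = 0)"
proof -
  have "(\<forall>k>2*n. pole_coeff g a b k = 0) \<longleftrightarrow>
      (\<forall>k>n. coeff a k = 0) \<and> (\<forall>k. k + g \<ge> n \<longrightarrow> coeff b k = 0)" (is "?L \<longleftrightarrow> ?R")
  proof
    assume L: ?L
    show ?R
      using L[rule_format, of "2 * k" for k] L[rule_format, of "2 * k + (2 * g + 1)" for k]
      unfolding pole_coeff_even pole_coeff_odd by auto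
  next
    assume ?R
    then show ?L by (auto simp: pole_coeff_def)
  qed
  then show ?thesis by (simp add: has_pole_order_def pole_coeff_even)
qed

lemma has_pole_order_odd_iff:
  "has_pole_order g a b (2 * n + (2 * g + 1)) \<longleftrightarrow>
     coeff b n \<noteq> 0 \<and> (\<forall>k>n. coeff b k = 0) \<and> (\<forall>k>n + g. coeff a k = 0)"
proof -
  have "(\<forall>k>2*n + (2*g+1). pole_coeff g a b k = 0) \<longleftrightarrow>
      (\<forall>k>n. coeff b k = 0) \<and> (\<forall>k>n + g. coeff a k = 0)" (is "?L \<longleftrightarrow> ?R")
  proof
    assume L: ?L
    show ?R
      using L[rule_format, of "2 * k" for k] L[rule_format, of "2 * k + (2 * g + 1)" for k]
      unfolding pole_coeff_even pole_coeff_odd by auto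
  next
    assume ?R
    moreover have "(k - Suc (2 * g)) div 2 > n" if "odd k" "Suc (2 * n + 2 * g) < k" for k
      using that by (elim oddE) (auto simp flip: diff_mult_distrib2)
    ultimately show ?L by (auto simp: pole_coeff_def)
  qed
  then show ?thesis unfolding has_pole_order_def pole_coeff_odd by simp
qed

text \<open>Odd numbers below 2g + 1 are gaps: \<open>pole_coeff\<close> is 0 there.\<close>

lemma has_pole_order_cases:
  assumes "has_pole_order g a b n"
  obtains m where "n = 2 * m" | m where "n = 2 * m + (2 * g + 1)"
proof (cases "even n")
  case True
  then show ?thesis using that by blast
next
  case False
  moreover have "n \<ge> 2 * g + 1"
    using assms False by (auto simp: has_pole_order_def pole_coeff_def split: if_splits)
  ultimately have "even (n - (2 * g + 1))" by simp
  then obtain m where "n - (2 * g + 1) = 2 * m" by blast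
  with \<open>n \<ge> 2 * g + 1\<close> show ?thesis by (intro that(2)[of m]) simp
qed

text \<open>m and n only bound the degrees, so a top coefficient may vanish, as happens for h when
  its degree is below g.\<close>

lemma coeff_mult_top:
  fixes p r :: "'a::comm_ring_1 poly"
  assumes "\<forall>k>m. coeff p k = 0" "\<forall>k>n. coeff r k = 0"
  shows "coeff (p * r) (m + n) = coeff p m * coeff r n" "\<forall>k>m+n. coeff (p * r) k = 0"
proof -
  have d: "degree p \<le> m" "degree r \<le> n" using assms by (auto intro: degree_le)
  show "\<forall>k>m+n. coeff (p * r) k = 0"
    using d degree_mult_le[of p r] by (auto intro!: coeff_eq_0)
  have "coeff (p * r) (m + n) = (\<Sum>i\<le>m+n. coeff p i * coeff r (m + n - i))"
    by (simp add: coeff_mult)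
  also have "\<dots> = (\<Sum>i\<in>{m}. coeff p i * coeff r (m + n - i))"
  proof (rule sum.mono_neutral_right)
    show "\<forall>i\<in>{..m+n} - {m}. coeff p i * coeff r (m + n - i) = 0"
    proof
      fix i assume "i \<in> {..m+n} - {m}"
      then have "i > m \<or> m + n - i > n" by auto
      then show "coeff p i * coeff r (m + n - i) = 0" using assms by auto
    qed
  qed auto
  finally show "coeff (p * r) (m + n) = coeff p m * coeff r n" by simp
qed

text \<open>This is y (a + b y) = b E + (a - b h) y. If the pole comes from a, the new one comes
  from a y, and b h has smaller degree than a; if it comes from b y, the new one comes from b
  E.\<close>

lemma has_pole_order_mult_y:
  fixes a b h E :: "'a::idom poly"
  assumes h: "degree h \<le> g" and E: "degree E = 2 * g + 1" and ab: "has_pole_order g a b n"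
  shows "has_pole_order g (b * E) (a - b * h) (n + (2 * g + 1))"
  using ab
proof (cases rule: has_pole_order_cases)
  case (1 m)
  have a: "coeff a m \<noteq> 0" "\<forall>k>m. coeff a k = 0" and b: "\<forall>k. k + g \<ge> m \<longrightarrow> coeff b k = 0"
    using ab unfolding 1 has_pole_order_even_iff by auto
  have bh: "coeff (b * h) k = 0" if "k \<ge> m" for k
  proof (cases "b = 0")
    case False
    then have "degree b + g < m" using b by (meson leading_coeff_0_iff not_le)
    then show ?thesis using that h degree_mult_le[of b h] by (intro coeff_eq_0) linarith
  qed simp
  have bE: "coeff (b * E) k = 0" if "k > m + g" for k
  proof (cases "b = 0")
    case False
    then have "degree b + g < m" using b by (meson leading_coeff_0_iff not_le)
    then show ?thesis using that E degree_mult_le[of b E] by (intro coeff_eq_0) linarith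
  qed simp
  show ?thesis unfolding 1 has_pole_order_odd_iff using a bh bE by simp
next
  case (2 m)
  have b: "coeff b m \<noteq> 0" "\<forall>k>m. coeff b k = 0" and a: "\<forall>k>m+g. coeff a k = 0"
    using ab unfolding 2 has_pole_order_odd_iff by auto
  have E0: "E \<noteq> 0" using E by auto
  have Et: "\<forall>k>2*g+1. coeff E k = 0" using E by (simp add: coeff_eq_0)
  have ht: "\<forall>k>g. coeff h k = 0" using h by (simp add: coeff_eq_0)
  have "coeff E (2 * g + 1) \<noteq> 0" using E E0 by (metis leading_coeff_0_iff)
  then have bE: "coeff (b * E) (m + (2 * g + 1)) \<noteq> 0"
    using coeff_mult_top(1)[OF b(2) Et] b(1) by simp
  have "n + (2 * g + 1) = 2 * (m + (2 * g + 1))" using 2 by simp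
  then show ?thesis
    using bE coeff_mult_top(2)[OF b(2) Et] coeff_mult_top(2)[OF b(2) ht] a
    by (simp only: has_pole_order_even_iff) auto
qed

lemma has_pole_order_y_power:
  fixes h E :: "'a::idom poly"
  assumes "degree h \<le> g" "degree E = 2 * g + 1"
  shows "has_pole_order g (fst (y_power h E n)) (snd (y_power h E n)) ((2 * g + 1) * n)"
proof (induction n)
  case 0
  show ?case using has_pole_order_even_iff[of g 1 0 0] by auto
next
  case (Suc n)
  then show ?case using has_pole_order_mult_y[OF assms Suc.IH] by (simp add: algebra_simps)
qed

lemma has_pole_order_mult_x_power:
  fixes a b :: "'a::idom poly"
  assumes ab: "has_pole_order g a b n"
  shows "has_pole_order g (monom 1 i * a) (monom 1 i * b) (2 * i + n)"
  using ab
proof (cases rule: has_pole_order_cases)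
  case (1 m)
  have e: "2 * i + n = 2 * (i + m)" using 1 by simp
  show ?thesis using ab unfolding e unfolding 1 has_pole_order_even_iff
    by (auto simp: coeff_monom_mult)
next
  case (2 m)
  have e: "2 * i + n = 2 * (i + m) + (2 * g + 1)" using 2 by simp
  show ?thesis using ab unfolding e unfolding 2 has_pole_order_odd_iff
    by (auto simp: coeff_monom_mult)
qed

lemma y_power_poly_over:
  assumes "is_subfield F" "h \<in> poly_over F" "E \<in> poly_over F"
  shows "fst (y_power h E n) \<in> poly_over F \<and> snd (y_power h E n) \<in> poly_over F"
proof (induction n)
  case 0
  show ?case by (simp add: assms poly_over_0 poly_over_1)
next
  case (Suc n)
  have "fst (y_power h E n) + smult (-1) (snd (y_power h E n) * h) \<in> poly_over F"
    using Suc assms by (intro poly_over_add poly_over_smult poly_over_mult is_subfield_closed) auto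
  then show ?case using Suc assms by (simp add: poly_over_mult)
qed

lemma pole_coeff_in_subfield:
  assumes "is_subfield F" "a \<in> poly_over F" "b \<in> poly_over F"
  shows "pole_coeff g a b n \<in> F"
  using assms by (auto simp: pole_coeff_def poly_over_def is_subfield_zero)

section \<open>The semigroup of pole orders generated by 2 and 2g + 1\<close>

definition pole_orders :: "nat \<Rightarrow> nat \<Rightarrow> nat set" where
  "pole_orders g N = {n. n \<le> N \<and> (even n \<or> 2 * g + 1 \<le> n)}"

text \<open>The basis function with a pole of order n is x^i y^j with j \<le> 1; as 2g + 1 is odd, j
  is the parity of n.\<close>

definition x_exponent :: "nat \<Rightarrow> nat \<Rightarrow> nat" where
  "x_exponent g n = (if even n then n div 2 else (n - (2 * g + 1)) div 2)"

definition y_exponent :: "nat \<Rightarrow> nat" where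
  "y_exponent n = n mod 2"

lemma finite_pole_orders: "finite (pole_orders g N)"
  by (rule finite_subset[of _ "{..N}"]) (auto simp: pole_orders_def)

text \<open>The g gaps are the odd numbers below 2g + 1, all of them in range if N \<ge> 2g. This
  count takes the place of the Riemann-Roch theorem.\<close>

lemma card_pole_orders:
  assumes "2 * g \<le> N"
  shows "card (pole_orders g N) = N + 1 - g"
proof -
  have "pole_orders g N = {..N} - (\<lambda>i. 2 * i + 1) ` {..<g}"
  proof (intro set_eqI iffI)
    fix n assume "n \<in> {..N} - (\<lambda>i. 2 * i + 1) ` {..<g}"
    then show "n \<in> pole_orders g N" by (cases "even n") (auto simp: pole_orders_def elim!: oddE)
  qed (auto simp: pole_orders_def)
  moreover have "(\<lambda>i. 2 * i + 1) ` {..<g} \<subseteq> {..N}" using assms by auto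
  moreover have "card ((\<lambda>i. 2 * i + 1) ` {..<g}) = g"
    by (subst card_image) (auto simp: inj_on_def)
  ultimately show ?thesis by (simp add: card_Diff_subset)
qed

lemma pole_order_exponents:
  assumes "n \<in> pole_orders g N"
  shows "2 * x_exponent g n + (2 * g + 1) * y_exponent n = n"
  using assms by (auto simp: pole_orders_def x_exponent_def y_exponent_def elim!: oddE
      simp flip: diff_mult_distrib2)

text \<open>The function x^i y^j in coordinates (a, b). Large j occur, since powers of basis
  functions are multiplied.\<close>

definition curve_monomial :: "'a::comm_ring_1 poly \<Rightarrow> 'a poly \<Rightarrow> nat \<Rightarrow> nat \<Rightarrow> 'a poly \<times> 'a poly" where
  "curve_monomial h E i j =
     (monom 1 i * fst (y_power h E j), monom 1 i * snd (y_power h E j))"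

lemma poly_curve_monomial:
  assumes "y\<^sup>2 + poly h x * y = poly E x"
  shows "poly (fst (curve_monomial h E i j)) x + poly (snd (curve_monomial h E i j)) x * y
    = x ^ i * y ^ j"
proof -
  have "poly (fst (curve_monomial h E i j)) x + poly (snd (curve_monomial h E i j)) x * y
    = x ^ i * (poly (fst (y_power h E j)) x + poly (snd (y_power h E j)) x * y)"
    by (simp add: curve_monomial_def poly_monom algebra_simps)
  then show ?thesis using poly_y_power[OF assms] by simp
qed

lemma has_pole_order_curve_monomial:
  fixes h E :: "'a::idom poly"
  assumes "degree h \<le> g" "degree E = 2 * g + 1"
  shows "has_pole_order g (fst (curve_monomial h E i j)) (snd (curve_monomial h E i j))
           (2 * i + (2 * g + 1) * j)"
  using has_pole_order_mult_x_power[OF has_pole_order_y_power[OF assms]]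
  by (simp add: curve_monomial_def)

lemma curve_monomial_poly_over:
  assumes "is_subfield F" "h \<in> poly_over F" "E \<in> poly_over F"
  shows "fst (curve_monomial h E i j) \<in> poly_over F" "snd (curve_monomial h E i j) \<in> poly_over F"
  using y_power_poly_over[OF assms]
  by (auto simp: curve_monomial_def assms(1) intro!: poly_over_mult poly_over_monom is_subfield_closed)

section \<open>Stepanov's method in characteristic two\<close>

text \<open>Formulated for a subset because it is used both for the field with q elements and for K,
  inside the same ambient field.\<close>

locale binary_subfield =
  fixes F :: "'a::field set" and q :: nat
  assumes F: "is_subfield F" and finite_F: "finite F" and card_F: "card F = q"
    and char_2: "CHAR('a) = 2"
begin

lemma power_q: "x \<in> F \<Longrightarrow> x ^ q = x"
  using subfield_power_card[OF F finite_F] card_F by simp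

lemma q_gt_1: "q > 1"
proof -
  have "card {0::'a, 1} \<le> card F"
    by (intro card_mono) (use finite_F in \<open>auto simp: is_subfield_closed F\<close>)
  then show ?thesis by (simp add: card_F)
qed

lemma minus_eq: "- x = (x :: 'a)"
  using char_2 by (rule uminus_CHAR_2)

lemma diff_eq_add: "x - y = x + (y :: 'a)"
  using char_2 by (rule minus_CHAR_2)

lemma add_self: "x + x = (0 :: 'a)"
  using diff_eq_add[of x x] by simp

lemma add_self_left: "x + (x + y) = (y :: 'a)"
  using add_self[of x] by (simp flip: add.assoc)

lemma two_eq_0: "(2 :: 'a) = 0"
  using add_self[of 1] by (simp only: one_add_one)

lemma power_2_power_add: "(x + y :: 'a) ^ 2 ^ n = x ^ 2 ^ n + y ^ 2 ^ n"
  by (rule freshmans_dream'[where n = n]) (simp_all add: char_2)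

lemma power2_add: "(x + y :: 'a)\<^sup>2 = x\<^sup>2 + y\<^sup>2"
  using power_2_power_add[of x y 1] by simp

lemma power_2_power_sum: "(\<Sum>i\<in>I. f i :: 'a) ^ 2 ^ n = (\<Sum>i\<in>I. f i ^ 2 ^ n)"
  by (rule freshmans_dream_sum'[where n = n]) (simp_all add: char_2)

text \<open>
  Bombieri's version of Stepanov's method. The function \<open>\<Psi> = \<Sum>\<tau>(n,k) s\<^sub>n\<^sup>v s\<^sub>k\<close> is made to vanish
  identically by counting coefficients; since \<open>s\<^sub>k\<^sup>q\<close> and \<open>s\<^sub>k\<close> agree at rational points,
  \<open>\<Phi> = \<Sum>\<tau>(n,k)\<^sup>u s\<^sub>n s\<^sub>k\<^sup>u\<close> then vanishes at all of them, while \<open>\<Phi> \<noteq> 0\<close> because its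
  terms have pairwise distinct pole orders \<open>n + u k\<close>.
\<close>
lemma stepanov_bound:
  assumes h: "h \<in> poly_over F" "degree h \<le> g" and E: "E \<in> poly_over F" "degree E = 2 * g + 1"
    and q: "q = u * v" and u: "u = 2 ^ i" and v: "v = 2 ^ j"
    and l: "2 * l < u" "g \<le> l" and m: "g \<le> m"
    and dim: "2 * l * v + 2 * m + 1 - g < (2 * l + 1 - g) * (2 * m + 1 - g)"
    and X: "X \<subseteq> F"
    and points: "\<And>x. x \<in> X \<Longrightarrow> poly h x \<noteq> 0 \<and> (\<exists>y\<in>F. y\<^sup>2 + poly h x * y = poly E x)"
  shows "card X \<le> l + m * u"
proof -
  let ?O = "pole_orders g" and ?X = "x_exponent g" and ?Y = "y_exponent"
  let ?a = "\<lambda>i j. fst (curve_monomial h E i j)" and ?b = "\<lambda>i j. snd (curve_monomial h E i j)"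
  define I where "I = ?O (2 * l) \<times> ?O (2 * m)"
  \<comment> \<open>No term of \<Psi> has a pole of order above 2lv + 2m, so these are the
    coefficients that have to vanish.\<close>
  define W where "W = ?O (2 * l * v + 2 * m)"
  have u0: "u > 0" and v0: "v > 0" using u v by simp_all
  have finI: "finite I" by (simp add: I_def finite_pole_orders)
  have cardI: "card I = (2 * l + 1 - g) * (2 * m + 1 - g)"
    using l m by (simp add: I_def card_cartesian_product card_pole_orders)
  have "2 * g \<le> 2 * l * v + 2 * m" using m by simp
  then have cardW: "card W = 2 * l * v + 2 * m + 1 - g" by (simp add: W_def card_pole_orders)
  define \<Psi> where "\<Psi> = (\<lambda>(n,k) w. pole_coeff g
      (?a (v * ?X n + ?X k) (v * ?Y n + ?Y k)) (?b (v * ?X n + ?X k) (v * ?Y n + ?Y k)) w)"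
  define G where "G = (\<lambda>\<tau>. \<lambda>w\<in>W. \<Sum>p\<in>I. \<tau> p * \<Psi> p w)"
  have \<Psi>F: "\<Psi> p w \<in> F" for p w
    unfolding \<Psi>_def by (auto split: prod.split
        intro!: pole_coeff_in_subfield curve_monomial_poly_over h E F)
  have G: "G ` (I \<rightarrow>\<^sub>E F) \<subseteq> W \<rightarrow>\<^sub>E F"
    unfolding G_def using F \<Psi>F by (fastforce intro!: is_subfield_sum is_subfield_mult)
  \<comment> \<open>Pigeonhole in place of linear algebra: G is additive, so two tuples with the
    same image differ by a nontrivial solution with entries in F.\<close>
  have "card (G ` (I \<rightarrow>\<^sub>E F)) \<le> card (W \<rightarrow>\<^sub>E F)"
    using G by (intro card_mono finite_PiE) (auto simp: W_def finite_pole_orders finite_F)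
  also have "\<dots> = q ^ card W" by (simp add: card_PiE W_def finite_pole_orders card_F)
  also have "\<dots> < q ^ card I" using dim q_gt_1 by (intro power_strict_increasing) (simp_all add: cardI cardW)
  also have "\<dots> = card (I \<rightarrow>\<^sub>E F)" by (simp add: card_PiE finI card_F)
  finally have "\<not> inj_on G (I \<rightarrow>\<^sub>E F)" by (rule pigeonhole)
  then obtain \<tau>1 \<tau>2 where \<tau>12: "\<tau>1 \<in> I \<rightarrow>\<^sub>E F" "\<tau>2 \<in> I \<rightarrow>\<^sub>E F" "\<tau>1 \<noteq> \<tau>2" "G \<tau>1 = G \<tau>2"
    by (auto simp: inj_on_def)
  define \<tau> where "\<tau> = (\<lambda>p. \<tau>1 p - \<tau>2 p)"
  have \<tau>F: "\<tau> p \<in> F" if "p \<in> I" for p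
    using \<tau>12 that F by (auto simp: \<tau>_def intro!: is_subfield_diff)
  obtain p0 where p0: "p0 \<in> I" "\<tau> p0 \<noteq> 0"
    using PiE_ext[OF \<tau>12(1,2)] \<tau>12(3) by (auto simp: \<tau>_def)

  have order: "has_pole_order g (?a i j) (?b i j) (2 * i + (2 * g + 1) * j)" for i j
    by (rule has_pole_order_curve_monomial[OF h(2) E(2)])
  have exps: "2 * ?X n + (2 * g + 1) * ?Y n = n" if "n \<in> ?O N" for n N
    using pole_order_exponents[OF that] .
  have \<Psi>0: "(\<Sum>p\<in>I. \<tau> p * \<Psi> p w) = 0" for w
  proof -
    consider "w \<in> W" | "w > 2 * l * v + 2 * m" | "odd w" "w < 2 * g + 1"
      unfolding W_def pole_orders_def using not_le by blast
    then show ?thesis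
    proof cases
      case 1
      have "(\<Sum>p\<in>I. \<tau>1 p * \<Psi> p w) = (\<Sum>p\<in>I. \<tau>2 p * \<Psi> p w)"
        using fun_cong[OF \<tau>12(4), of w] 1 by (simp add: G_def)
      then show ?thesis by (simp add: \<tau>_def algebra_simps sum_subtractf)
    next
      case 2
      have "\<Psi> p w = 0" if "p \<in> I" for p
      proof -
        obtain n k where p: "p = (n, k)" by (cases p)
        have nk: "n \<in> ?O (2 * l)" "k \<in> ?O (2 * m)" using that by (auto simp: I_def p)
        have "2 * (v * ?X n + ?X k) + (2 * g + 1) * (v * ?Y n + ?Y k)
            = v * (2 * ?X n + (2 * g + 1) * ?Y n) + (2 * ?X k + (2 * g + 1) * ?Y k)"
          by (simp add: algebra_simps)
        also have "\<dots> = v * n + k" using exps nk by simp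
        also have "\<dots> \<le> v * (2 * l) + 2 * m"
          using nk by (intro add_mono mult_left_mono) (auto simp: pole_orders_def)
        also have "\<dots> < w" using 2 by (simp add: mult.commute)
        finally show ?thesis
          using order unfolding \<Psi>_def p has_pole_order_def by simp
      qed
      then show ?thesis by simp
    next
      case 3
      then have "\<Psi> p w = 0" for p by (auto simp: \<Psi>_def pole_coeff_def split: prod.split)
      then show ?thesis by simp
    qed
  qed
  let ?A = "\<Sum>(n,k)\<in>I. smult (\<tau> (n,k)) (?a (v * ?X n + ?X k) (v * ?Y n + ?Y k))"
  let ?B = "\<Sum>(n,k)\<in>I. smult (\<tau> (n,k)) (?b (v * ?X n + ?X k) (v * ?Y n + ?Y k))"
  have pc: "pole_coeff g ?A ?B w = 0" for w
    using \<Psi>0[of w] pole_coeff_sum[of g \<tau> "\<lambda>(n,k). ?a (v * ?X n + ?X k) (v * ?Y n + ?Y k)" I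
        "\<lambda>(n,k). ?b (v * ?X n + ?X k) (v * ?Y n + ?Y k)" w]
    by (simp add: \<Psi>_def case_prod_unfold)
  have A0: "?A = 0"
    by (rule poly_eqI) (use pc pole_coeff_even in \<open>simp only: coeff_0 flip: pole_coeff_even[of g ?A ?B]\<close>)
  have B0: "?B = 0"
    by (rule poly_eqI) (use pc in \<open>simp only: coeff_0 flip: pole_coeff_odd[of g ?A ?B]\<close>)

  define A where "A = (\<Sum>p\<in>I. smult (\<tau> p ^ u)
      (?a (?X (fst p) + u * ?X (snd p)) (?Y (fst p) + u * ?Y (snd p))))"
  define B where "B = (\<Sum>p\<in>I. smult (\<tau> p ^ u)
      (?b (?X (fst p) + u * ?X (snd p)) (?Y (fst p) + u * ?Y (snd p))))"
  have vanish: "poly A x + poly B x * y = 0"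
    if x: "x \<in> F" and y: "y \<in> F" and xy: "y\<^sup>2 + poly h x * y = poly E x" for x y
  proof -
    have eq: "poly A x + poly B x * y
      = (\<Sum>p\<in>I. \<tau> p ^ u * (x ^ (?X (fst p) + u * ?X (snd p)) * y ^ (?Y (fst p) + u * ?Y (snd p))))"
      unfolding A_def B_def
      by (simp add: poly_sum sum_distrib_right mult.assoc sum.distrib[symmetric]
          distrib_left[symmetric] poly_curve_monomial[OF xy])
    \<comment> \<open>Raising to the power v is additive and turns each term into \<tau>^q s_n^v
      s_k^q. At a rational point the q-th powers disappear, which leaves \<Psi>.\<close>
    have "(poly A x + poly B x * y) ^ v = (\<Sum>p\<in>I. (\<tau> p ^ u * (x ^ (?X (fst p) + u * ?X (snd p)) *
        y ^ (?Y (fst p) + u * ?Y (snd p)))) ^ v)"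
      unfolding v eq by (rule power_2_power_sum)
    also have "\<dots> = (\<Sum>p\<in>I. \<tau> p * (x ^ (v * ?X (fst p) + ?X (snd p)) *
        y ^ (v * ?Y (fst p) + ?Y (snd p))))"
    proof (rule sum.cong[OF refl])
      fix p assume p: "p \<in> I"
      have "(z ^ (r + u * s)) ^ v = z ^ (v * r + s)" if "z \<in> F" for z r s
      proof -
        have "(z ^ (r + u * s)) ^ v = z ^ (v * r) * (z ^ q) ^ s"
          by (simp add: q algebra_simps power_add flip: power_mult)
        then show ?thesis by (simp add: power_q[OF that] power_add)
      qed
      moreover have "(\<tau> p ^ u) ^ v = \<tau> p" using power_q[OF \<tau>F[OF p]] by (simp add: q power_mult)
      ultimately show "(\<tau> p ^ u * (x ^ (?X (fst p) + u * ?X (snd p)) *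
          y ^ (?Y (fst p) + u * ?Y (snd p)))) ^ v
        = \<tau> p * (x ^ (v * ?X (fst p) + ?X (snd p)) * y ^ (v * ?Y (fst p) + ?Y (snd p)))"
        using x y by (simp add: power_mult_distrib)
    qed
    also have "\<dots> = poly ?A x + poly ?B x * y"
      by (simp add: case_prod_unfold poly_sum sum_distrib_right mult.assoc sum.distrib[symmetric]
          distrib_left[symmetric] poly_curve_monomial[OF xy])
    also have "\<dots> = 0" by (simp only: A0 B0) simp
    finally show ?thesis using v0 by simp
  qed

  have orderp: "has_pole_order g
      (?a (?X (fst p) + u * ?X (snd p)) (?Y (fst p) + u * ?Y (snd p)))
      (?b (?X (fst p) + u * ?X (snd p)) (?Y (fst p) + u * ?Y (snd p))) (fst p + u * snd p)"
    if p: "p \<in> I" for p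
  proof -
    obtain n k where p': "p = (n, k)" by (cases p)
    have nk: "n \<in> ?O (2 * l)" "k \<in> ?O (2 * m)" using p by (auto simp: I_def p')
    have "2 * (?X n + u * ?X k) + (2 * g + 1) * (?Y n + u * ?Y k)
        = (2 * ?X n + (2 * g + 1) * ?Y n) + u * (2 * ?X k + (2 * g + 1) * ?Y k)"
      by (simp add: algebra_simps)
    also have "\<dots> = n + u * k" using exps nk by simp
    finally show ?thesis using order[of "?X n + u * ?X k" "?Y n + u * ?Y k"] by (simp add: p')
  qed
  define \<Phi> where "\<Phi> = (\<lambda>p w. pole_coeff g
      (?a (?X (fst p) + u * ?X (snd p)) (?Y (fst p) + u * ?Y (snd p)))
      (?b (?X (fst p) + u * ?X (snd p)) (?Y (fst p) + u * ?Y (snd p))) w)"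
  have AB: "pole_coeff g A B w = (\<Sum>p\<in>I. \<tau> p ^ u * \<Phi> p w)" for w
    unfolding A_def B_def \<Phi>_def by (rule pole_coeff_sum)

  define J where "J = {p\<in>I. \<tau> p \<noteq> 0}"
  have "finite J" "p0 \<in> J" using finI p0 by (simp_all add: J_def)
  then have "finite J" "J \<noteq> {}" by auto
  then have "Max ((\<lambda>p. fst p + u * snd p) ` J) \<in> (\<lambda>p. fst p + u * snd p) ` J"
    by (intro Max_in) auto
  then obtain t where t: "t \<in> J" and tMax: "Max ((\<lambda>p. fst p + u * snd p) ` J) = fst t + u * snd t"
    by blast
  have tmax: "fst p + u * snd p \<le> fst t + u * snd t" if "p \<in> J" for p
    unfolding tMax[symmetric] using \<open>finite J\<close> that by (intro Max_ge) auto
  define w where "w = fst t + u * snd t"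
  \<comment> \<open>Since n \<le> 2l < u, the order n + u k is a division with remainder by u and
    determines n and k.\<close>
  have inj: "p = t" if "p \<in> I" "fst p + u * snd p = w" for p
  proof -
    have "fst p < u" "fst t < u" using that t l by (auto simp: J_def I_def pole_orders_def)
    then have "(fst p + u * snd p) mod u = fst p" "(fst t + u * snd t) mod u = fst t"
      "(fst p + u * snd p) div u = snd p" "(fst t + u * snd t) div u = snd t" by simp_all
    then show ?thesis using that(2) by (metis prod_eqI w_def)
  qed
  have "pole_coeff g A B w = (\<Sum>p\<in>{t}. \<tau> p ^ u * \<Phi> p w)"
    unfolding AB
  proof (rule sum.mono_neutral_right[OF finI])
    show "{t} \<subseteq> I" using t by (simp add: J_def)
    show "\<forall>p\<in>I - {t}. \<tau> p ^ u * \<Phi> p w = 0"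
    proof
      fix p assume p: "p \<in> I - {t}"
      show "\<tau> p ^ u * \<Phi> p w = 0"
      proof (cases "\<tau> p = 0")
        case False
        then have "fst p + u * snd p \<le> w" using tmax[of p] p by (simp add: J_def w_def)
        moreover have "fst p + u * snd p \<noteq> w" using inj[of p] p by blast
        ultimately have "fst p + u * snd p < w" by simp
        then show ?thesis using orderp p by (simp add: \<Phi>_def has_pole_order_def)
      qed (use u0 in simp)
    qed
  qed
  also have "\<dots> \<noteq> 0" using t orderp[of t] by (simp add: J_def \<Phi>_def has_pole_order_def w_def)
  finally have "pole_coeff g A B w \<noteq> 0" .
  moreover have "pole_coeff g 0 0 w = (0 :: 'a)" by (simp add: pole_coeff_def)
  ultimately have AB0: "A \<noteq> 0 \<or> B \<noteq> 0" by auto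

  have top: "pole_coeff g A B k = 0" if k: "k > 2 * l + u * (2 * m)" for k
    unfolding AB
  proof (intro sum.neutral ballI)
    fix p assume p: "p \<in> I"
    have "fst p + u * snd p \<le> 2 * l + u * (2 * m)"
      using p by (intro add_mono mult_left_mono) (auto simp: I_def pole_orders_def)
    then show "\<tau> p ^ u * \<Phi> p k = 0" using orderp[OF p] k by (simp add: \<Phi>_def has_pole_order_def)
  qed
  \<comment> \<open>Half of the largest possible pole order, since x has a double pole.\<close>
  have degA: "degree A \<le> l + m * u"
    by (intro degree_le allI impI) (use top in \<open>auto simp: algebra_simps simp flip: pole_coeff_even[of g A B]\<close>)
  have degB: "degree B \<le> l + m * u"
  proof (intro degree_le allI impI)
    fix k assume "l + m * u < k"
    then have "2 * k + (2 * g + 1) > 2 * l + u * (2 * m)" by (simp add: algebra_simps)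
    then show "coeff B k = 0" using top by (simp only: flip: pole_coeff_odd[of g A B])
  qed
  \<comment> \<open>Over x lie the two points y and y + h(x), distinct as h(x) \<noteq> 0. Vanishing
    of A + B y at both forces A and B to vanish at x.\<close>
  have roots: "poly A x = 0 \<and> poly B x = 0" if "x \<in> X" for x
  proof -
    from points[OF that]
    obtain y where hx: "poly h x \<noteq> 0" and y: "y \<in> F" "y\<^sup>2 + poly h x * y = poly E x"
      by auto
    have x: "x \<in> F" using that X by auto
    have hF: "poly h x \<in> F" using h(1) x F
      by (auto simp: poly_altdef poly_over_def intro!: is_subfield_closed)
    have "(y + poly h x)\<^sup>2 + poly h x * (y + poly h x)
        = y\<^sup>2 + poly h x * y + (poly h x * poly h x + poly h x * poly h x)"
      unfolding power2_add by (simp add: algebra_simps power2_eq_square)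
    then have y': "(y + poly h x)\<^sup>2 + poly h x * (y + poly h x) = poly E x"
      using y add_self by simp
    have v1: "poly A x + poly B x * y = 0" by (rule vanish[OF x y])
    have v2: "poly A x + poly B x * (y + poly h x) = 0"
      by (rule vanish[OF x _ y']) (use y hF F in \<open>auto intro: is_subfield_add\<close>)
    have "poly B x * poly h x = (poly A x + poly B x * (y + poly h x)) - (poly A x + poly B x * y)"
      by (simp add: algebra_simps)
    then have "poly B x = 0" using v1 v2 hx by simp
    then show ?thesis using v1 by simp
  qed
  have "card X \<le> l + m * u" if "P \<noteq> 0" "degree P \<le> l + m * u" "\<And>x. x \<in> X \<Longrightarrow> poly P x = 0" for P
  proof -
    have "card X \<le> card {x. poly P x = 0}"
      using that by (intro card_mono poly_roots_finite) auto
    also have "\<dots> \<le> degree P" by (rule card_poly_roots_bound[OF that(1)])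
    finally show ?thesis using that(2) by simp
  qed
  then show ?thesis using AB0 degA degB roots by blast
qed

section \<open>The Artin-Schreier map and its character\<close>

text \<open>The elements of absolute trace zero, so that \<open>\<chi>\<close> below is the nontrivial quadratic
  additive character of \<open>F\<close>.\<close>
definition wp :: "'a set" where
  "wp = (\<lambda>y. y\<^sup>2 + y) ` F"

definition \<chi> :: "'a \<Rightarrow> int" where
  "\<chi> w = (if w \<in> wp then 1 else - 1)"

lemma wp_subset: "wp \<subseteq> F"
  by (auto simp: wp_def F intro!: is_subfield_closed)

lemma wp_add: "a \<in> wp \<Longrightarrow> b \<in> wp \<Longrightarrow> a + b \<in> wp"
proof -
  assume "a \<in> wp" "b \<in> wp"
  then obtain y z where "y \<in> F" "z \<in> F" "a = y\<^sup>2 + y" "b = z\<^sup>2 + z" by (auto simp: wp_def)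
  then show "a + b \<in> wp"
    unfolding wp_def by (intro image_eqI[of _ _ "y + z"]) (auto simp: power2_add F is_subfield_add)
qed

lemma wp_0: "0 \<in> wp"
  unfolding wp_def by (rule image_eqI[of _ _ 0]) (simp_all add: F is_subfield_zero)

lemma square_eq_iff: "x\<^sup>2 = y\<^sup>2 \<longleftrightarrow> x = (y :: 'a)"
  using power2_eq_iff[of x y] by (simp add: minus_eq)

text \<open>The fibres of y \<mapsto> y^2 + y are the pairs {y, y + 1}.\<close>

lemma card_wp: "2 * card wp = q"
proof -
  have "card F = (\<Sum>w\<in>wp. card {y\<in>F. y\<^sup>2 + y = w})"
    unfolding wp_def
    by (subst card_UN_disjoint[symmetric]) (auto simp: finite_F intro: arg_cong[where f = card])
  also have "\<dots> = (\<Sum>w\<in>wp. 2)"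
  proof (rule sum.cong[OF refl])
    fix w assume "w \<in> wp"
    then obtain y where y: "y \<in> F" "w = y\<^sup>2 + y" by (auto simp: wp_def)
    have "{z\<in>F. z\<^sup>2 + z = w} = {y, y + 1}"
    proof (intro equalityI subsetI)
      fix z assume "z \<in> {z\<in>F. z\<^sup>2 + z = w}"
      then have "z\<^sup>2 + z = w" by simp
      moreover have "(z + y) * (z + y + 1) = (z\<^sup>2 + z) + (y\<^sup>2 + y) + 2 * (z * y)"
        by (simp add: algebra_simps power2_eq_square)
      ultimately have "(z + y) * (z + y + 1) = 0"
        by (simp only: y(2)[symmetric] two_eq_0 add_self) simp
      then have "z + y = 0 \<or> z + y = 1" by (simp add: add_eq_0_iff2 minus_eq)
      moreover have "z = (z + y) + y" by (simp add: add.assoc add_self)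
      ultimately have "z = y \<or> z = y + 1" by (metis add.commute add.left_neutral)
      then show "z \<in> {y, y + 1}" by auto
    next
      fix z assume "z \<in> {y, y + 1}"
      then show "z \<in> {z\<in>F. z\<^sup>2 + z = w}"
        using y add_self_left[of 1 y] by (auto simp: power2_add F add_ac intro!: is_subfield_closed)
    qed
    then show "card {z\<in>F. z\<^sup>2 + z = w} = 2" by simp
  qed
  finally show ?thesis by (simp add: card_F)
qed

text \<open>By \<open>card_wp\<close> the subgroup \<open>wp\<close> has index 2, so it has only one
  nontrivial coset.\<close>

lemma add_nonmembers_wp:
  assumes "a \<in> F" "b \<in> F" "a \<notin> wp" "b \<notin> wp"
  shows "a + b \<in> wp"
proof -
  have fin: "finite wp" using finite_subset[OF wp_subset finite_F] .
  have c: "card ((+) a ` wp) = card wp" by (simp add: card_image)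
  have dis: "wp \<inter> (+) a ` wp = {}"
  proof (rule ccontr)
    assume "\<not> ?thesis"
    then obtain w where "w \<in> wp" "a + w \<in> wp" by auto
    then have "(a + w) + w \<in> wp" using wp_add[of "a + w" w] by blast
    then show False using assms(3) by (simp only: add.assoc add_self add_0_right)
  qed
  have "wp \<union> (+) a ` wp = F"
  proof (rule card_subset_eq[OF finite_F])
    show "wp \<union> (+) a ` wp \<subseteq> F" using wp_subset assms(1) F by (auto intro: is_subfield_add)
    show "card (wp \<union> (+) a ` wp) = card F"
      using card_wp fin dis c by (simp add: card_Un_disjoint card_F)
  qed
  then obtain w where "w \<in> wp" "b = a + w" using assms by auto
  then show ?thesis by (simp add: add_self_left)
qed

lemma add_in_wp_iff:
  assumes "a \<in> F" "b \<in> F"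
  shows "a + b \<in> wp \<longleftrightarrow> (a \<in> wp \<longleftrightarrow> b \<in> wp)"
proof -
  have "y \<in> wp" if "x + y \<in> wp" "x \<in> wp" for x y
    using wp_add[OF that(2,1)] by (simp only: add_self_left)
  note this[of a b] this[of b a, unfolded add.commute[of b a]]
  then show ?thesis using wp_add[of a b] add_nonmembers_wp[OF assms] by blast
qed

lemma chi_add: "a \<in> F \<Longrightarrow> b \<in> F \<Longrightarrow> \<chi> (a + b) = \<chi> a * \<chi> b"
  by (simp add: \<chi>_def add_in_wp_iff)

lemma chi_0: "\<chi> 0 = 1"
  by (simp add: \<chi>_def wp_0)

lemma chi_sum: "(\<And>i. i \<in> I \<Longrightarrow> f i \<in> F) \<Longrightarrow> \<chi> (\<Sum>i\<in>I. f i) = (\<Prod>i\<in>I. \<chi> (f i))"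
  by (induction I rule: infinite_finite_induct)
    (auto simp: chi_0 chi_add is_subfield_sum F)

lemma square_in_wp_iff:
  assumes "w \<in> F"
  shows "w\<^sup>2 \<in> wp \<longleftrightarrow> w \<in> wp"
proof -
  have "w\<^sup>2 + w \<in> wp" using assms by (auto simp: wp_def)
  then show ?thesis using add_in_wp_iff[of "w\<^sup>2" w] assms F by (simp add: is_subfield_power)
qed

lemma obtain_nonmember_wp:
  obtains \<theta> where "\<theta> \<in> F" "\<theta> \<notin> wp"
proof -
  have "wp \<noteq> F" using card_wp card_F q_gt_1 by auto
  then show ?thesis using wp_subset that by blast
qed

text \<open>With h the product of the x + \<eta>, the substitution y = h w turns w^2 + w = c0 x +
  \<theta> + ... into y^2 + h y = E with E of degree 2g + 1. As q = u v, the bound says that twice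
  the cardinality is at most q + 2 g u + v - 2.\<close>

lemma card_artin_schreier_affine:
  assumes q: "q = u * v" and u: "u = 2 ^ i" and v: "v = 2 ^ j" and uv: "v \<le> u"
    and \<Gamma>: "finite \<Gamma>" "\<Gamma> \<subseteq> F" "card \<Gamma> = g" and c: "\<And>\<eta>. \<eta> \<in> \<Gamma> \<Longrightarrow> c \<eta> \<in> F"
    and c0: "c0 \<in> F" "c0 \<noteq> 0" and \<theta>: "\<theta> \<in> F"
    and big: "(g + 1) * (g + 2) < v"
  shows "2 * card {x \<in> F - \<Gamma>. c0 * x + \<theta> + (\<Sum>\<eta>\<in>\<Gamma>. c \<eta> / (x + \<eta>)) \<in> wp} + 2
           \<le> v + (v + 2 * g) * u"
proof -
  define h where "h = (\<Prod>\<eta>\<in>\<Gamma>. [:\<eta>, 1:])"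
  define N where "N = (\<Sum>\<eta>\<in>\<Gamma>. smult (c \<eta>) (h * (\<Prod>\<eta>'\<in>\<Gamma> - {\<eta>}. [:\<eta>', 1:])))"
  define E where "E = h * h * [:\<theta>, c0:] + N"
  \<comment> \<open>With these values the factors in the dimension condition are v - (g + 1) and v +
    (g + 1), and the condition reduces to \<open>(g + 1) * (g + 2) < v\<close>.\<close>
  define l where "l = v div 2 - 1"
  define m where "m = v div 2 + g"
  have "v \<noteq> 1" using big by auto
  then have "even v" unfolding v by (cases j) auto
  then obtain v' where v': "v = 2 * v'" by blast
  have big': "(g + 1) * (g + 1) + g + 1 < 2 * v'" using big by (simp add: v')
  then have v'pos: "v' \<ge> 1" and gl: "g + 1 \<le> v'" by (auto simp: algebra_simps)
  have h0: "h \<noteq> 0" using \<Gamma> by (simp add: h_def)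
  have degh: "degree h = g"
    unfolding h_def using \<Gamma> by (subst degree_prod_eq_sum_degree) auto
  have lin: "[:\<eta>, 1:] \<in> poly_over F" if "\<eta> \<in> \<Gamma>" for \<eta>
    using that \<Gamma> F by (intro poly_over_linear is_subfield_one) auto
  have hF: "h \<in> poly_over F"
    unfolding h_def by (intro poly_over_prod F lin)
  have EF: "E \<in> poly_over F"
    unfolding E_def N_def
    by (intro poly_over_add[OF F] poly_over_mult[OF F] poly_over_sum[OF F] poly_over_smult[OF F]
        poly_over_prod[OF F] lin hF c poly_over_linear[OF F \<theta> c0(1)]) auto
  have d1: "degree (h * h * [:\<theta>, c0:]) = 2 * g + 1"
    using h0 c0 by (simp add: degree_mult_eq degh del: mult_pCons_right)
  have d2: "degree N < 2 * g + 1"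
  proof -
    have "degree N \<le> 2 * g"
      unfolding N_def
    proof (rule degree_sum_le[OF \<Gamma>(1)])
      fix \<eta> assume \<eta>: "\<eta> \<in> \<Gamma>"
      have "degree (\<Prod>\<eta>'\<in>\<Gamma> - {\<eta>}. [:\<eta>', 1:]) = card (\<Gamma> - {\<eta>})"
        by (subst degree_prod_eq_sum_degree) auto
      also have "\<dots> \<le> g" using \<Gamma> \<eta> by (simp add: card_Diff_singleton)
      finally have "degree (h * (\<Prod>\<eta>'\<in>\<Gamma> - {\<eta>}. [:\<eta>', 1:])) \<le> 2 * g"
        using degree_mult_le[of h "\<Prod>\<eta>'\<in>\<Gamma> - {\<eta>}. [:\<eta>', 1:]"] degh by linarith
      then show "degree (smult (c \<eta>) (h * (\<Prod>\<eta>'\<in>\<Gamma> - {\<eta>}. [:\<eta>', 1:]))) \<le> 2 * g"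
        using degree_smult_le order_trans by blast
    qed
    then show ?thesis by simp
  qed
  have degE: "degree E = 2 * g + 1"
    unfolding E_def using d1 d2 by (simp add: degree_add_eq_left)
  have hx: "poly h x \<noteq> 0" if "x \<in> F - \<Gamma>" for x
  proof -
    have "\<eta> + x \<noteq> 0" if "\<eta> \<in> \<Gamma>" for \<eta>
      using that \<open>x \<in> F - \<Gamma>\<close> by (metis DiffE add.right_neutral add_self_left)
    then show ?thesis using \<Gamma> by (simp add: h_def poly_prod)
  qed
  have polyE: "poly E x = (poly h x)\<^sup>2 * (c0 * x + \<theta> + (\<Sum>\<eta>\<in>\<Gamma>. c \<eta> / (x + \<eta>)))"
    if x: "x \<in> F - \<Gamma>" for x
  proof -
    have "poly (h * (\<Prod>\<eta>'\<in>\<Gamma> - {\<eta>}. [:\<eta>', 1:])) x = (poly h x)\<^sup>2 / (x + \<eta>)"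
      if \<eta>: "\<eta> \<in> \<Gamma>" for \<eta>
    proof -
      have "poly h x = (\<eta> + x) * poly (\<Prod>\<eta>'\<in>\<Gamma> - {\<eta>}. [:\<eta>', 1:]) x"
        unfolding h_def using \<Gamma> \<eta> by (subst prod.remove[of _ \<eta>]) (simp_all add: algebra_simps)
      moreover have "\<eta> + x \<noteq> 0" using \<eta> x by (metis DiffE add.right_neutral add_self_left)
      ultimately show ?thesis by (simp add: field_simps power2_eq_square)
    qed
    then have "poly N x = (\<Sum>\<eta>\<in>\<Gamma>. (poly h x)\<^sup>2 * (c \<eta> / (x + \<eta>)))"
      unfolding N_def poly_sum by (intro sum.cong refl) (simp del: poly_mult)
    then have "poly N x = (poly h x)\<^sup>2 * (\<Sum>\<eta>\<in>\<Gamma>. c \<eta> / (x + \<eta>))"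
      by (simp only: sum_distrib_left)
    then show ?thesis by (simp add: E_def algebra_simps power2_eq_square)
  qed
  let ?S = "{x \<in> F - \<Gamma>. c0 * x + \<theta> + (\<Sum>\<eta>\<in>\<Gamma>. c \<eta> / (x + \<eta>)) \<in> wp}"
  have "card ?S \<le> l + m * u"
  proof (rule stepanov_bound[OF hF _ EF degE q u v])
    show "degree h \<le> g" using degh by simp
    show "2 * l < u" using uv v'pos by (simp add: l_def v')
    show "g \<le> l" "g \<le> m" using gl by (simp_all add: l_def m_def v')
    show "2 * l * v + 2 * m + 1 - g < (2 * l + 1 - g) * (2 * m + 1 - g)"
    proof -
      obtain k where k: "v' = g + 1 + k" using gl by (metis le_Suc_ex)
      have "2 * l + 1 - g = g + 1 + 2 * k" "2 * m + 1 - g = 3 * g + 3 + 2 * k"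
        "2 * m + 1 = 4 * g + 3 + 2 * k" "l = g + k"
        by (simp_all add: l_def m_def v' k)
      moreover have "(g + 1) * (g + 1) + g + 1 < 2 * g + 2 + 2 * k" using big' by (simp add: k)
      ultimately show ?thesis by (simp add: v' k algebra_simps)
    qed
    show "?S \<subseteq> F" by auto
    fix x assume x: "x \<in> ?S"
    then obtain y where y: "y \<in> F" "c0 * x + \<theta> + (\<Sum>\<eta>\<in>\<Gamma>. c \<eta> / (x + \<eta>)) = y\<^sup>2 + y"
      by (auto simp: wp_def)
    have "poly h x \<in> F" using hF x F
      by (auto simp: poly_altdef poly_over_def intro!: is_subfield_closed)
    moreover have "(poly h x * y)\<^sup>2 + poly h x * (poly h x * y) = poly E x"
    proof -
      have "poly E x = (poly h x)\<^sup>2 * (y\<^sup>2 + y)" using polyE[of x] x y by simp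
      then show ?thesis by (simp add: algebra_simps power2_eq_square)
    qed
    ultimately show "poly h x \<noteq> 0 \<and> (\<exists>y\<in>F. y\<^sup>2 + poly h x * y = poly E x)"
      using hx[of x] x y F by (auto intro!: bexI[of _ "poly h x * y"] is_subfield_mult)
  qed
  moreover have "2 * l + 2 = v" using v'pos by (simp add: l_def v')
  moreover have "v + 2 * g = 2 * m" by (simp add: m_def v')
  then have "(v + 2 * g) * u = 2 * (m * u)" by (simp only: mult.assoc)
  ultimately show ?thesis by linarith
qed

text \<open>The substitution \<open>x = \<gamma>\<^sub>0 + 1/z\<close> moves one of the poles to infinity.\<close>
lemma card_artin_schreier:
  assumes q: "q = u * v" and u: "u = 2 ^ i" and v: "v = 2 ^ j" and uv: "v \<le> u"
    and S: "S \<subseteq> F" "card S = g + 1" and \<delta>: "\<And>\<gamma>. \<gamma> \<in> S \<Longrightarrow> \<delta> \<gamma> \<in> F"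
    and \<gamma>0: "\<gamma>0 \<in> S" "\<delta> \<gamma>0 \<noteq> 0"
    and big: "(g + 1) * (g + 2) < v"
  shows "2 * card {x \<in> F - S. (\<Sum>\<gamma>\<in>S. \<delta> \<gamma> / (x + \<gamma>)) \<notin> wp} + 2 \<le> v + (v + 2 * g) * u"
proof -
  \<comment> \<open>Adding an element outside \<open>wp\<close> exchanges values inside and outside
    \<open>wp\<close>, so the upper bound applies to the complementary count.\<close>
  obtain \<theta> where \<theta>: "\<theta> \<in> F" "\<theta> \<notin> wp" by (rule obtain_nonmember_wp)
  have finS: "finite S" using S finite_F finite_subset by blast
  define T where "T = S - {\<gamma>0}"
  have T: "finite T" "T \<subseteq> F" "card T = g" using finS S \<gamma>0 by (auto simp: T_def)
  define f where "f = (\<lambda>\<gamma>. 1 / (\<gamma>0 + \<gamma>))"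
  have nz: "\<gamma>0 + \<gamma> \<noteq> 0" if "\<gamma> \<noteq> \<gamma>0" for \<gamma> using that by (metis add.right_neutral add_self_left)
  have injf: "inj_on f T"
    unfolding f_def T_def using nz by (auto simp: inj_on_def)
  define \<Gamma> where "\<Gamma> = f ` T"
  have fT: "f \<gamma> \<in> F" if "\<gamma> \<in> T" for \<gamma>
    using that T \<gamma>0 S F unfolding f_def by (intro is_subfield_divide is_subfield_add is_subfield_one) auto
  have \<Gamma>: "finite \<Gamma>" "\<Gamma> \<subseteq> F" "card \<Gamma> = g"
    using T fT injf by (auto simp: \<Gamma>_def card_image)
  \<comment> \<open>For z = 1/(\<gamma>0 + x) and f = 1/(\<gamma>0 + \<gamma>) one has \<delta>/(x +
    \<gamma>) = \<delta> f + \<delta> f^2/(z + f). The residue is written in terms of the new pole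
    \<eta> = f by \<gamma> = \<gamma>0 + 1/\<eta>; the constants \<delta> f are collected in
    \<open>\<theta>'\<close>.\<close>
  define c where "c = (\<lambda>\<eta>. \<delta> (\<gamma>0 + 1 / \<eta>) * \<eta>\<^sup>2)"
  have cf: "c (f \<gamma>) = \<delta> \<gamma> * (f \<gamma>)\<^sup>2" if "\<gamma> \<in> T" for \<gamma>
    by (simp add: c_def f_def add_self_left)
  have cF: "c \<eta> \<in> F" if "\<eta> \<in> \<Gamma>" for \<eta>
  proof -
    from that obtain \<gamma> where \<gamma>: "\<gamma> \<in> T" "\<eta> = f \<gamma>" by (auto simp: \<Gamma>_def)
    then have "\<delta> \<gamma> \<in> F" "f \<gamma> \<in> F" using \<delta> fT by (auto simp: T_def)
    then show ?thesis using \<gamma> cf F by (simp add: is_subfield_mult is_subfield_power)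
  qed
  define \<theta>' where "\<theta>' = \<theta> + (\<Sum>\<gamma>\<in>T. \<delta> \<gamma> * f \<gamma>)"
  have \<theta>'F: "\<theta>' \<in> F"
    unfolding \<theta>'_def using \<theta> fT \<delta> F by (auto simp: T_def intro!: is_subfield_closed)
  let ?R = "\<lambda>z. \<delta> \<gamma>0 * z + \<theta>' + (\<Sum>\<eta>\<in>\<Gamma>. c \<eta> / (z + \<eta>))"
  let ?A = "{x \<in> F - S. (\<Sum>\<gamma>\<in>S. \<delta> \<gamma> / (x + \<gamma>)) \<notin> wp}"
  let ?B = "{z \<in> F - \<Gamma>. ?R z \<in> wp}"
  let ?\<phi> = "\<lambda>x. 1 / (\<gamma>0 + x)"
  have "card ?A \<le> card ?B"
  proof (rule card_inj_on_le)
    show "inj_on ?\<phi> ?A" using nz \<gamma>0(1) by (auto simp: inj_on_def)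
    show "finite ?B" using finite_F by auto
    show "?\<phi> ` ?A \<subseteq> ?B"
    proof (rule image_subsetI)
      fix x assume "x \<in> ?A"
      then have x: "x \<in> F" "x \<notin> S" and ns: "(\<Sum>\<gamma>\<in>S. \<delta> \<gamma> / (x + \<gamma>)) \<notin> wp" by auto
      have x0: "\<gamma>0 + x \<noteq> 0" using nz[of x] x \<gamma>0(1) by blast
      have xg: "x + \<gamma> \<noteq> 0" if "\<gamma> \<in> S" for \<gamma>
        using that x by (metis add.right_neutral add_self_left)
      have zF: "?\<phi> x \<in> F" using x \<gamma>0 S F by (intro is_subfield_divide is_subfield_add is_subfield_one) auto
      have z\<Gamma>: "?\<phi> x \<notin> \<Gamma>"
        using x nz x0 by (auto simp: \<Gamma>_def f_def T_def)
      have summand: "\<delta> \<gamma> * f \<gamma> + c (f \<gamma>) / (?\<phi> x + f \<gamma>) = \<delta> \<gamma> / (x + \<gamma>)" if g: "\<gamma> \<in> T" for \<gamma>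
      proof -
        define p r where "p = \<gamma>0 + \<gamma>" and "r = \<gamma>0 + x"
        have p: "p \<noteq> 0" and r: "r \<noteq> 0" using nz g x0 by (auto simp: p_def r_def T_def)
        have pr: "p + r = x + \<gamma>"
          using add_self_left[of \<gamma>0 "x + \<gamma>"] by (simp add: p_def r_def algebra_simps)
        then have pr0: "p + r \<noteq> 0" using xg[of \<gamma>] g by (simp add: T_def)
        have "\<delta> \<gamma> * (1/p) + (\<delta> \<gamma> * (1/p)\<^sup>2) / (1/r + 1/p) = \<delta> \<gamma> * ((p + (r + r)) / (p * (p + r)))"
          using p r pr0 by (simp add: divide_simps power2_eq_square) (simp add: algebra_simps)
        also have "\<dots> = \<delta> \<gamma> / (p + r)" using p by (simp add: add_self)
        also have "p + r = x + \<gamma>" by (rule pr)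
        finally show ?thesis using cf[OF g] by (simp only: f_def p_def r_def)
      qed
      have "?R (?\<phi> x) = \<delta> \<gamma>0 * ?\<phi> x + \<theta> + ((\<Sum>\<gamma>\<in>T. \<delta> \<gamma> * f \<gamma>) + (\<Sum>\<gamma>\<in>T. c (f \<gamma>) / (?\<phi> x + f \<gamma>)))"
        unfolding \<Gamma>_def by (simp add: sum.reindex[OF injf] \<theta>'_def add.assoc)
      also have "\<dots> = \<theta> + (\<delta> \<gamma>0 / (x + \<gamma>0) + (\<Sum>\<gamma>\<in>T. \<delta> \<gamma> / (x + \<gamma>)))"
      proof -
        have "(\<Sum>\<gamma>\<in>T. \<delta> \<gamma> * f \<gamma>) + (\<Sum>\<gamma>\<in>T. c (f \<gamma>) / (?\<phi> x + f \<gamma>))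
            = (\<Sum>\<gamma>\<in>T. \<delta> \<gamma> / (x + \<gamma>))"
          unfolding sum.distrib[symmetric] by (rule sum.cong[OF refl summand])
        then show ?thesis by (simp add: add_ac)
      qed
      also have "\<dots> = \<theta> + (\<Sum>\<gamma>\<in>S. \<delta> \<gamma> / (x + \<gamma>))"
        unfolding T_def using sum.remove[OF finS \<gamma>0(1), of "\<lambda>\<gamma>. \<delta> \<gamma> / (x + \<gamma>)"] by simp
      also have "\<dots> \<in> wp"
      proof (rule add_nonmembers_wp[OF \<theta>(1) _ \<theta>(2) ns])
        show "(\<Sum>\<gamma>\<in>S. \<delta> \<gamma> / (x + \<gamma>)) \<in> F"
          using \<delta> x S F by (intro is_subfield_sum is_subfield_divide is_subfield_add) auto
      qed
      finally show "?\<phi> x \<in> ?B" using zF z\<Gamma> by simp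
    qed
  qed
  moreover have "2 * card ?B + 2 \<le> v + (v + 2 * g) * u"
    using \<delta> \<gamma>0 by (intro card_artin_schreier_affine[OF q u v uv \<Gamma> cF _ _ \<theta>'F big]) auto
  ultimately show ?thesis by linarith
qed

section \<open>Character sums detecting simultaneous conditions\<close>

lemma sum_chi: "finite A \<Longrightarrow> (\<Sum>x\<in>A. \<chi> (f x)) = int (card A) - 2 * int (card {x\<in>A. f x \<notin> wp})"
proof -
  assume A: "finite A"
  have "(\<Sum>x\<in>A. \<chi> (f x)) = (\<Sum>x\<in>A. 1 - 2 * (if f x \<notin> wp then 1 else 0))"
    by (intro sum.cong) (auto simp: \<chi>_def)
  also have "\<dots> = int (card A) - 2 * (\<Sum>x\<in>A. if f x \<notin> wp then 1 else 0)"
    by (simp add: sum_subtractf sum_distrib_left)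
  also have "(\<Sum>x\<in>A. if f x \<notin> wp then 1 else 0 :: int) = int (card {x\<in>A. f x \<notin> wp})"
    using A by (simp add: sum.If_cases Int_def)
  finally show ?thesis .
qed

text \<open>If the character were -1 at d, translation by d would change the sign of the
  sum.\<close>

lemma sum_chi_subgroup:
  assumes D: "D \<subseteq> F" "\<And>a b. a \<in> D \<Longrightarrow> b \<in> D \<Longrightarrow> a + b \<in> D"
    and z: "z \<in> F" and ne: "(\<Sum>d\<in>D. \<chi> (d * z)) \<noteq> 0" and d: "d \<in> D"
  shows "\<chi> (d * z) = 1"
proof (rule ccontr)
  assume "\<chi> (d * z) \<noteq> 1"
  then have m: "\<chi> (d * z) = - 1" by (auto simp: \<chi>_def split: if_splits)
  have "(\<Sum>e\<in>D. \<chi> (e * z)) = (\<Sum>e\<in>D. \<chi> ((d + e) * z))"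
    by (rule sum.reindex_bij_witness[of _ "(+) d" "(+) d"]) (use D d in \<open>auto simp: add_self_left\<close>)
  also have "\<dots> = (\<Sum>e\<in>D. - \<chi> (e * z))"
  proof (rule sum.cong[OF refl])
    fix e assume "e \<in> D"
    then have "d * z \<in> F" "e * z \<in> F" using D(1) d z F by (auto intro: is_subfield_mult)
    then show "\<chi> ((d + e) * z) = - \<chi> (e * z)" by (simp add: distrib_right chi_add m)
  qed
  finally show False using ne by (simp add: sum_negf)
qed

text \<open>The product over \<gamma> of the sums over D \<gamma> is nonzero only at r where all
  conditions hold. Summed over r and expanded, it consists of q - N from the zero tuple and of one
  sum for every other tuple, which is at least minus the corresponding summand of
  \<open>bound\<close>.\<close>

lemma exists_simultaneous_trivial_character:
  assumes q: "q = u * v" and u: "u = 2 ^ i" and v: "v = 2 ^ j" and uv: "v \<le> u"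
    and S: "S \<subseteq> F" "card S = N" and big: "N * (N + 1) < v"
    and D: "\<And>\<gamma>. \<gamma> \<in> S \<Longrightarrow> D \<gamma> \<subseteq> F" "\<And>\<gamma>. \<gamma> \<in> S \<Longrightarrow> 0 \<in> D \<gamma>"
      "\<And>\<gamma> a b. \<gamma> \<in> S \<Longrightarrow> a \<in> D \<gamma> \<Longrightarrow> b \<in> D \<gamma> \<Longrightarrow> a + b \<in> D \<gamma>"
    and bound: "(\<Sum>\<delta>\<in>(\<Pi>\<^sub>E \<gamma>\<in>S. D \<gamma>) - {\<lambda>\<gamma>\<in>S. 0}.
        2 * (int (card {\<gamma>\<in>S. \<delta> \<gamma> \<noteq> 0}) - 1) * int u + int v + int N) < int q - int N"
  shows "\<exists>r\<in>F - S. \<forall>\<gamma>\<in>S. \<forall>d\<in>D \<gamma>. \<chi> (d / (r + \<gamma>)) = 1"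
proof -
  have finS: "finite S" using S finite_F finite_subset by blast
  have finD: "finite (D \<gamma>)" if "\<gamma> \<in> S" for \<gamma> using D(1)[OF that] finite_F finite_subset by blast
  define T where "T = (\<Pi>\<^sub>E \<gamma>\<in>S. D \<gamma>)"
  define z where "z = (\<lambda>\<gamma>\<in>S. 0 :: 'a)"
  have finT: "finite T" unfolding T_def using finS finD by (rule finite_PiE)
  have zT: "z \<in> T" using D by (auto simp: z_def T_def)
  have nz: "r + \<gamma> \<noteq> 0" if "r \<in> F - S" "\<gamma> \<in> S" for r \<gamma>
    using that by (metis DiffE add.right_neutral add_self_left)
  have invF: "inverse (r + \<gamma>) \<in> F" if "r \<in> F - S" "\<gamma> \<in> S" for r \<gamma>
    using that S F by (auto intro!: is_subfield_closed)
  have \<delta>F: "\<delta> \<gamma> \<in> F" if "\<delta> \<in> T" "\<gamma> \<in> S" for \<delta> \<gamma> using that D(1) by (auto simp: T_def PiE_iff)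
  have cFS: "card (F - S) = q - N" "N \<le> q"
    using S finS finite_F card_F by (auto simp: card_Diff_subset intro: card_mono)
  define R where "R = (\<lambda>\<delta> r. \<Sum>\<gamma>\<in>S. \<delta> \<gamma> * inverse (r + \<gamma>))"

  have lower: "- (2 * (int (card {\<gamma>\<in>S. \<delta> \<gamma> \<noteq> 0}) - 1) * int u + int v + int N)
      \<le> (\<Sum>r\<in>F-S. \<chi> (R \<delta> r))" if \<delta>: "\<delta> \<in> T - {z}" for \<delta>
  proof -
    define S' where "S' = {\<gamma>\<in>S. \<delta> \<gamma> \<noteq> 0}"
    obtain \<gamma>0 where \<gamma>0: "\<gamma>0 \<in> S'"
    proof (cases "S' = {}")
      case True
      have "\<delta> = z"
        using \<delta> True by (intro PiE_ext[of \<delta> S D z]) (auto simp: T_def S'_def z_def D)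
      then show ?thesis using \<delta> by simp
    qed blast
    \<comment> \<open>Only the support of \<delta> gives poles, and one of them is moved to
      infinity.\<close>
    define g where "g = card S' - 1"
    have finS': "finite S'" using finS by (simp add: S'_def)
    have S': "S' \<subseteq> F" "card S' = g + 1"
      using S \<gamma>0 finS' card_gt_0_iff[of S'] by (auto simp: S'_def g_def)
    have "g + 1 \<le> N" using S' card_mono[OF finS, of S'] S by (auto simp: S'_def)
    then have "(g + 1) * (g + 2) \<le> N * (N + 1)" by (intro mult_mono) auto
    then have "(g + 1) * (g + 2) < v" using big by simp
    then have b: "2 * card {x \<in> F - S'. (\<Sum>\<gamma>\<in>S'. \<delta> \<gamma> / (x + \<gamma>)) \<notin> wp} + 2 \<le> v + (v + 2 * g) * u"
      using \<delta> \<delta>F \<gamma>0 by (intro card_artin_schreier[OF q u v uv S' _ \<gamma>0]) (auto simp: S'_def)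
    have Req: "R \<delta> x = (\<Sum>\<gamma>\<in>S'. \<delta> \<gamma> / (x + \<gamma>))" for x
      unfolding R_def divide_inverse
      by (rule sum.mono_neutral_right[OF finS]) (auto simp: S'_def)
    have "card {r \<in> F - S. R \<delta> r \<notin> wp} \<le> card {x \<in> F - S'. (\<Sum>\<gamma>\<in>S'. \<delta> \<gamma> / (x + \<gamma>)) \<notin> wp}"
      by (intro card_mono) (use finite_F Req in \<open>auto simp: S'_def\<close>)
    then have "2 * int (card {r \<in> F - S. R \<delta> r \<notin> wp}) \<le> int (v + (v + 2 * g) * u)"
      using b by linarith
    also have "\<dots> = int v + int q + 2 * int g * int u" by (simp add: q algebra_simps)
    finally have "2 * int (card {r \<in> F - S. R \<delta> r \<notin> wp}) \<le> int v + int q + 2 * int g * int u" .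
    moreover have "(\<Sum>r\<in>F-S. \<chi> (R \<delta> r)) = int q - int N - 2 * int (card {r\<in>F-S. R \<delta> r \<notin> wp})"
      using sum_chi[of "F - S" "R \<delta>"] finite_F cFS by (simp add: of_nat_diff)
    moreover have "int (card S') - 1 = int g" using S' by simp
    ultimately show ?thesis unfolding S'_def[symmetric] by simp
  qed

  have "(\<Sum>r\<in>F-S. \<Prod>\<gamma>\<in>S. \<Sum>d\<in>D \<gamma>. \<chi> (d * inverse (r + \<gamma>)))
      = (\<Sum>r\<in>F-S. \<Sum>\<delta>\<in>T. \<Prod>\<gamma>\<in>S. \<chi> (\<delta> \<gamma> * inverse (r + \<gamma>)))"
    unfolding T_def using finS finD by (intro sum.cong refl prod_sum_PiE) auto
  also have "\<dots> = (\<Sum>r\<in>F-S. \<Sum>\<delta>\<in>T. \<chi> (R \<delta> r))"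
    unfolding R_def using \<delta>F invF F
    by (intro sum.cong refl chi_sum[symmetric]) (auto intro: is_subfield_mult)
  also have "\<dots> = (\<Sum>\<delta>\<in>T. \<Sum>r\<in>F-S. \<chi> (R \<delta> r))" by (rule sum.swap)
  also have "\<dots> = (\<Sum>r\<in>F-S. \<chi> (R z r)) + (\<Sum>\<delta>\<in>T - {z}. \<Sum>r\<in>F-S. \<chi> (R \<delta> r))"
    by (rule sum.remove[OF finT zT])
  also have "(\<Sum>r\<in>F-S. \<chi> (R z r)) = int q - int N"
    using cFS by (simp add: R_def z_def chi_0 of_nat_diff)
  finally have total: "(\<Sum>r\<in>F-S. \<Prod>\<gamma>\<in>S. \<Sum>d\<in>D \<gamma>. \<chi> (d * inverse (r + \<gamma>)))
      = int q - int N + (\<Sum>\<delta>\<in>T - {z}. \<Sum>r\<in>F-S. \<chi> (R \<delta> r))" .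
  have "(\<Sum>\<delta>\<in>T - {z}. \<Sum>r\<in>F-S. \<chi> (R \<delta> r)) \<ge>
      (\<Sum>\<delta>\<in>T - {z}. - (2 * (int (card {\<gamma>\<in>S. \<delta> \<gamma> \<noteq> 0}) - 1) * int u + int v + int N))"
    by (rule sum_mono[OF lower])
  then have "(\<Sum>r\<in>F-S. \<Prod>\<gamma>\<in>S. \<Sum>d\<in>D \<gamma>. \<chi> (d * inverse (r + \<gamma>))) > 0"
    using bound unfolding total T_def[symmetric] z_def[symmetric] sum_negf by linarith
  then have "(\<Sum>r\<in>F-S. \<Prod>\<gamma>\<in>S. \<Sum>d\<in>D \<gamma>. \<chi> (d * inverse (r + \<gamma>))) \<noteq> 0" by simp
  then obtain r where r: "r \<in> F - S" and ne: "(\<Prod>\<gamma>\<in>S. \<Sum>d\<in>D \<gamma>. \<chi> (d * inverse (r + \<gamma>))) \<noteq> 0"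
    by (rule sum.not_neutral_contains_not_neutral)
  have "\<chi> (d / (r + \<gamma>)) = 1" if "\<gamma> \<in> S" "d \<in> D \<gamma>" for \<gamma> d
    unfolding divide_inverse
    by (rule sum_chi_subgroup[of "D \<gamma>"]) (use ne finS that D invF[OF r] in auto)
  with r show ?thesis by blast
qed

end

section \<open>Supports of tuples\<close>

lemma card_PiE_vanishing:
  assumes "finite S" "\<gamma> \<in> S" "0 \<in> D \<gamma>" "\<And>\<gamma>. \<gamma> \<in> S \<Longrightarrow> finite (D \<gamma>)"
  shows "card (D \<gamma>) * card {\<delta> \<in> (\<Pi>\<^sub>E \<gamma>\<in>S. D \<gamma>). \<delta> \<gamma> = 0} = card (\<Pi>\<^sub>E \<gamma>\<in>S. D \<gamma>)"
proof -
  have "{\<delta> \<in> (\<Pi>\<^sub>E \<gamma>\<in>S. D \<gamma>). \<delta> \<gamma> = 0} = Pi\<^sub>E S (D(\<gamma> := {0}))"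
    using assms(2,3) by (auto simp: PiE_iff extensional_def split: if_splits)
  then have "card {\<delta> \<in> (\<Pi>\<^sub>E \<gamma>\<in>S. D \<gamma>). \<delta> \<gamma> = 0} = (\<Prod>\<gamma>'\<in>S. card ((D(\<gamma> := {0})) \<gamma>'))"
    using assms(1) by (simp add: card_PiE)
  also have "\<dots> = (\<Prod>\<gamma>'\<in>S - {\<gamma>}. card (D \<gamma>'))"
    using assms(1,2) by (subst prod.remove[of S \<gamma>]) auto
  finally show ?thesis using assms(1,2) by (simp add: card_PiE prod.remove[of S \<gamma>])
qed

text \<open>Double counting of the pairs (\<delta>, \<gamma>) with \<delta> \<gamma> \<noteq>
  0.\<close>

lemma sum_card_support_PiE:
  fixes D :: "'a \<Rightarrow> 'b::zero set"
  assumes S: "finite S" and D: "\<And>\<gamma>. \<gamma> \<in> S \<Longrightarrow> finite (D \<gamma>)"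
  shows "(\<Sum>\<delta>\<in>(\<Pi>\<^sub>E \<gamma>\<in>S. D \<gamma>). int (card {\<gamma>\<in>S. \<delta> \<gamma> \<noteq> 0})) =
    (\<Sum>\<gamma>\<in>S. int (card (\<Pi>\<^sub>E \<gamma>\<in>S. D \<gamma>)) - int (card {\<delta> \<in> (\<Pi>\<^sub>E \<gamma>\<in>S. D \<gamma>). \<delta> \<gamma> = 0}))"
proof -
  let ?T = "\<Pi>\<^sub>E \<gamma>\<in>S. D \<gamma>"
  have fin: "finite ?T" using S D by (rule finite_PiE)
  have "(\<Sum>\<delta>\<in>?T. int (card {\<gamma>\<in>S. \<delta> \<gamma> \<noteq> 0})) = (\<Sum>\<delta>\<in>?T. \<Sum>\<gamma>\<in>S. if \<delta> \<gamma> \<noteq> 0 then 1 else 0)"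
    using S by (simp add: sum.If_cases Int_def)
  also have "\<dots> = (\<Sum>\<gamma>\<in>S. \<Sum>\<delta>\<in>?T. if \<delta> \<gamma> \<noteq> 0 then 1 else 0)" by (rule sum.swap)
  also have "\<dots> = (\<Sum>\<gamma>\<in>S. int (card ?T) - int (card {\<delta> \<in> ?T. \<delta> \<gamma> = 0}))"
  proof (rule sum.cong[OF refl])
    fix \<gamma>
    have "card ?T = card ({\<delta> \<in> ?T. \<delta> \<gamma> \<noteq> 0} \<union> {\<delta> \<in> ?T. \<delta> \<gamma> = 0})"
      by (rule arg_cong[where f = card]) auto
    also have "\<dots> = card {\<delta> \<in> ?T. \<delta> \<gamma> \<noteq> 0} + card {\<delta> \<in> ?T. \<delta> \<gamma> = 0}"
      using fin by (intro card_Un_disjoint) auto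
    finally show "(\<Sum>\<delta>\<in>?T. if \<delta> \<gamma> \<noteq> 0 then 1 else 0) = int (card ?T) - int (card {\<delta> \<in> ?T. \<delta> \<gamma> = 0})"
      using fin by (simp add: sum.If_cases Int_def)
  qed
  finally show ?thesis .
qed

section \<open>An element satisfying all trace conditions\<close>

context binary_subfield
begin

text \<open>With P = p^(2p-1) there are 2 p P tuples, of total weight P (2p - 1)^2, so the error has
  leading term 8 p^2 P u, to be compared with q = u v. For p = 2 this comparison would ask for v
  \<ge> 256, but the smallest admissible case s = 7 of the theorem only offers v = 128; there the
  lower order terms are kept.\<close>

lemma exists_good_element:
  assumes q: "q = u * v" and u: "u = 2 ^ i" and v: "v = 2 ^ j" and uv: "v \<le> u"
    and K: "is_subfield K" "K \<subseteq> F" "card K = 2 * p" and p: "p \<ge> 2"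
    and big: "8 * p ^ 2 * p ^ (2 * p - 1) \<le> v \<or> p = 2 \<and> 128 \<le> v"
    and D: "\<And>\<gamma>. \<gamma> \<in> K \<Longrightarrow> D \<gamma> \<subseteq> F" "\<And>\<gamma>. \<gamma> \<in> K \<Longrightarrow> 0 \<in> D \<gamma>"
      "\<And>\<gamma> a b. \<gamma> \<in> K \<Longrightarrow> a \<in> D \<gamma> \<Longrightarrow> b \<in> D \<gamma> \<Longrightarrow> a + b \<in> D \<gamma>"
    and cardD: "card (D 0) = 2 * p" "\<And>\<gamma>. \<gamma> \<in> K \<Longrightarrow> \<gamma> \<noteq> 0 \<Longrightarrow> card (D \<gamma>) = p"
  shows "\<exists>r\<in>F - K. \<forall>\<gamma>\<in>K. \<forall>d\<in>D \<gamma>. \<chi> (d / (r + \<gamma>)) = 1"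
proof (rule exists_simultaneous_trivial_character[OF q u v uv K(2,3) _ D])
  define P where "P = p ^ (2 * p - 1)"
  have "p ^ 1 \<le> P" unfolding P_def using p by (intro power_increasing) auto
  then have Pp: "p \<le> P" by simp
  have finK: "finite K" using K(2) finite_F finite_subset by blast
  have K0: "0 \<in> K" using K by (simp add: is_subfield_zero)
  have finD: "finite (D \<gamma>)" if "\<gamma> \<in> K" for \<gamma> using D(1)[OF that] finite_F finite_subset by blast
  let ?T = "\<Pi>\<^sub>E \<gamma>\<in>K. D \<gamma>"
  have "(\<Prod>\<gamma>\<in>K. card (D \<gamma>)) = 2 * p * (\<Prod>\<gamma>\<in>K - {0}. card (D \<gamma>))"
    by (simp add: prod.remove[OF finK K0] cardD)
  also have "(\<Prod>\<gamma>\<in>K - {0}. card (D \<gamma>)) = P"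
    using K0 finK K(3) by (simp add: cardD P_def)
  finally have cT: "card ?T = 2 * p * P" by (simp add: card_PiE finK)
  have v0: "card {\<delta> \<in> ?T. \<delta> \<gamma> = 0} = (if \<gamma> = 0 then P else 2 * P)" if "\<gamma> \<in> K" for \<gamma>
    using card_PiE_vanishing[where S = K and D = D, OF finK that D(2)[OF that] finD] cT cardD(1) cardD(2)[OF that] p
    by (auto split: if_splits)
  have "(\<Sum>\<delta>\<in>?T. int (card {\<gamma>\<in>K. \<delta> \<gamma> \<noteq> 0}))
      = (\<Sum>\<gamma>\<in>K. int (card ?T) - int (card {\<delta> \<in> ?T. \<delta> \<gamma> = 0}))"
    using finK finD by (rule sum_card_support_PiE)
  also have "\<dots> = (\<Sum>\<gamma>\<in>K. int (2 * p * P) - int (if \<gamma> = 0 then P else 2 * P))"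
    by (intro sum.cong refl) (simp only: cT v0)
  also have "\<dots> = int (2 * p * P) - int P + (\<Sum>\<gamma>\<in>K - {0}. int (2 * p * P) - 2 * int P)"
    unfolding sum.remove[OF finK K0] by simp
  also have "\<dots> = int (2 * p * P) - int P + (2 * int p - 1) * (int (2 * p * P) - 2 * int P)"
    using finK K0 K(3) p by (simp add: of_nat_diff)
  finally have wt: "(\<Sum>\<delta>\<in>?T. int (card {\<gamma>\<in>K. \<delta> \<gamma> \<noteq> 0})) = int P * (2 * int p - 1)\<^sup>2"
    by (simp add: algebra_simps power2_eq_square)
  let ?w = "\<lambda>\<delta>. 2 * (int (card {\<gamma>\<in>K. \<delta> \<gamma> \<noteq> 0}) - 1) * int u + int v + int (2 * p)"
  define z where "z = (\<lambda>\<gamma>\<in>K. 0 :: 'a)"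
  \<comment> \<open>The zero tuple has weight 0; its formal contribution -2u + v + 2p is taken out
    of the sum over all tuples.\<close>
  have "sum ?w ?T = ?w z + sum ?w (?T - {z})"
    by (rule sum.remove) (use D finK finD in \<open>auto simp: z_def intro!: finite_PiE\<close>)
  moreover have "{\<gamma> \<in> K. z \<gamma> \<noteq> 0} = {}" by (auto simp: z_def)
  ultimately have "sum ?w (?T - {z}) = sum ?w ?T + 2 * int u - int v - int (2 * p)"
    by (simp only: card.empty) simp
  also have "sum ?w ?T = 2 * int u * (\<Sum>\<delta>\<in>?T. int (card {\<gamma>\<in>K. \<delta> \<gamma> \<noteq> 0}))
      + int (card ?T) * (int v + int (2 * p) - 2 * int u)"
    by (simp add: sum.distrib sum_distrib_left algebra_simps sum_subtractf)
  finally have tot: "sum ?w (?T - {z}) = 2 * int u * (int P * (2 * int p - 1)\<^sup>2)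
      + 2 * int p * int P * (int v + 2 * int p - 2 * int u) + 2 * int u - int v - 2 * int p"
    unfolding wt cT by simp
  have Pu: "4 * int p * int p * int P \<le> int u" if "8 * p ^ 2 * P \<le> v"
  proof -
    have "4 * p * p * P \<le> u" using that uv by (simp add: power2_eq_square)
    then show ?thesis by (metis of_nat_le_iff of_nat_mult of_nat_numeral)
  qed
  have upper: "2 * int u * (int P * (2 * int p - 1)\<^sup>2)
      + 2 * int p * int P * (int v + 2 * int p - 2 * int u) + 2 * int u \<le> int u * int v"
    using big
  proof
    assume b: "8 * p ^ 2 * p ^ (2 * p - 1) \<le> v"
    then have b1: "8 * p ^ 2 * P \<le> v" by (simp add: P_def)
    have b2: "8 * int p * int p * int P \<le> int v"
    proof -
      have "8 * p * p * P \<le> v" using b1 by (simp add: power2_eq_square)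
      then show ?thesis by (metis of_nat_le_iff of_nat_mult of_nat_numeral)
    qed
    have "2 * int u * (int P * (2 * int p - 1)\<^sup>2)
      + 2 * int p * int P * (int v + 2 * int p - 2 * int u) + 2 * int u
      \<le> 2 * int u * (int P * (2 * int p - 1)\<^sup>2)
      + (2 * int p * int P * (int u - 2 * int u) + 4 * int p * int p * int P) + 2 * int u"
      using uv mult_left_mono[of "int v" "int u" "2 * int p * int P"] by (simp add: algebra_simps)
    also have "\<dots> \<le> 2 * int u * (int P * (2 * int p - 1)\<^sup>2)
      + (2 * int p * int P * (int u - 2 * int u) + int u) + 2 * int u"
      using Pu[OF b1] by simp
    also have "\<dots> = int u * (8 * int p * int p * int P - (10 * int p * int P - 2 * int P - 3))"
      by (simp add: algebra_simps power2_eq_square)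
    also have "\<dots> \<le> int u * int v"
    proof (rule mult_left_mono)
      have "2 * int P \<le> int p * int P" using p by (intro mult_right_mono) auto
      then show "8 * int p * int p * int P - (10 * int p * int P - 2 * int P - 3) \<le> int v"
        using b2 Pp p by linarith
    qed simp
    finally show ?thesis .
  next
    assume b: "p = 2 \<and> 128 \<le> v"
    \<comment> \<open>The left-hand side of the goal is now 82 u + 32 v + 128.\<close>
    then have P: "P = 8" by (simp add: P_def)
    have "int u * 128 \<le> int u * int v" using b by (intro mult_left_mono) auto
    moreover have "int v \<le> int u" "128 \<le> int u" using b uv by auto
    ultimately have "128 + (int v * 32 + int u * 82) \<le> int u * int v" by linarith
    then show ?thesis using b by (simp add: P algebra_simps)
  qed
  have "0 < v" using v by simp
  then show "sum ?w (?T - {\<lambda>\<gamma>\<in>K. 0}) < int q - int (2 * p)"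
    unfolding z_def[symmetric] tot using upper by (simp add: q)
  show "2 * p * (2 * p + 1) < v"
    using big
  proof
    assume "8 * p ^ 2 * p ^ (2 * p - 1) \<le> v"
    moreover have "2 * p * (2 * p + 1) < 8 * p ^ 2 * p"
    proof -
      have "2 * p \<le> p * p" "2 * (p * p) \<le> p * (p * p)" "0 < p * p"
        using p by (auto intro!: mult_le_mono1)
      then have "4 * (p * p) + 2 * p < 8 * (p * (p * p))" by linarith
      then show ?thesis by (simp add: power2_eq_square algebra_simps)
    qed
    moreover have "8 * p ^ 2 * p \<le> 8 * p ^ 2 * p ^ (2 * p - 1)"
      using Pp by (simp add: P_def)
    ultimately show ?thesis by linarith
  qed simp
qed

end

section \<open>Counting by fibres and by roots\<close>

lemma card_le_fibres:
  assumes "finite B" "f ` A \<subseteq> B" "\<And>b. b \<in> B \<Longrightarrow> card {a \<in> A. f a = b} \<le> n"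
  shows "card A \<le> n * card B"
proof -
  have "card A = card (\<Union>b\<in>B. {a \<in> A. f a = b})"
    using assms(2) by (intro arg_cong[where f = card]) auto
  also have "\<dots> \<le> (\<Sum>b\<in>B. card {a \<in> A. f a = b})" by (rule card_UN_le[OF assms(1)])
  also have "\<dots> \<le> (\<Sum>b\<in>B. n)" by (rule sum_mono[OF assms(3)])
  finally show ?thesis by (simp add: mult.commute)
qed

lemma card_power_eq_le:
  fixes c :: "'a::{field,finite}"
  assumes "n > 0"
  shows "card {x. x ^ n = c} \<le> n"
proof -
  let ?p = "monom 1 n - [:c:]"
  have "coeff ?p n = 1" using assms by (cases n) auto
  then have "?p \<noteq> 0" by (metis coeff_0 zero_neq_one)
  then have "card {x. poly ?p x = 0} \<le> degree ?p" by (rule card_poly_roots_bound)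
  also have "\<dots> \<le> n" by (intro degree_diff_le) (auto simp: degree_monom_le)
  finally show ?thesis by (simp add: poly_monom)
qed

section \<open>The unit circle\<close>

locale binary_quadratic_extension =
  fixes q e :: nat and F :: "'a::{field,finite} set"
  assumes card_UNIV: "CARD('a) = q\<^sup>2" and q_eq: "q = 2 ^ e" and e_pos: "e > 0"
    and F_eq: "F = {x. x ^ q = x}"
begin

lemma char_2': "CHAR('a) = 2"
proof (rule CHAR_2_of_even_subfield[of "UNIV :: 'a set"])
  show "is_subfield (UNIV :: 'a set)" by (simp add: is_subfield_def)
  show "even CARD('a)" using e_pos by (simp add: card_UNIV q_eq)
qed simp

lemma q_ge_2: "q \<ge> 2"
  using e_pos power_increasing[of 1 e "2 :: nat"] by (simp add: q_eq)

lemma power_q_q: "(x ^ q) ^ q = (x :: 'a)"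
  using subfield_power_card[of "UNIV :: 'a set" x]
  by (simp add: is_subfield_def card_UNIV power2_eq_square power_mult)

lemma power_q_add: "(x + y :: 'a) ^ q = x ^ q + y ^ q"
  unfolding q_eq by (rule freshmans_dream'[where n = e]) (simp_all add: char_2')

lemma is_subfield_F: "is_subfield F"
proof -
  have neg: "(- x :: 'a) = x" for x using char_2' by (rule uminus_CHAR_2)
  show ?thesis
    unfolding is_subfield_def F_eq neg
    using q_ge_2 by (auto simp: power_q_add power_mult_distrib power_inverse)
qed

lemma power_pred_Suc_q:
  assumes "x \<noteq> (0 :: 'a)"
  shows "x ^ ((q - 1) * (q + 1)) = 1"
proof -
  obtain k where k: "q = Suc k" using q_ge_2 by (cases q) auto
  have "(q - 1) * (q + 1) + 1 = q * q" by (simp add: k algebra_simps)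
  then have "x ^ ((q - 1) * (q + 1)) * x = x ^ (q * q)"
    by (metis power_add power_one_right)
  also have "\<dots> = x" using power_q_q[of x] by (simp add: power_mult)
  finally show ?thesis using assms by simp
qed

lemma units_count: "card (UNIV - {0 :: 'a}) = (q - 1) * (q + 1)"
proof -
  obtain k where k: "q = Suc k" using q_ge_2 by (cases q) auto
  show ?thesis by (simp add: card_Diff_subset card_UNIV k power2_eq_square algebra_simps)
qed

text \<open>Root counting gives one inequality. For the other, x \<mapsto> x^(q-1) maps the (q -
  1)(q + 1) units into the circle with fibres of at most q - 1 elements, so no generator of the unit
  group is needed.\<close>

lemma card_unit_circle: "card (unit_circle q :: 'a set) = q + 1"
proof (rule antisym)
  show "card (unit_circle q :: 'a set) \<le> q + 1"
    unfolding unit_circle_def by (rule card_power_eq_le) simp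
  have "card (UNIV - {0 :: 'a}) \<le> (q - 1) * card (unit_circle q :: 'a set)"
  proof (rule card_le_fibres[where f = "\<lambda>x. x ^ (q - 1)"])
    show "(\<lambda>x. x ^ (q - 1)) ` (UNIV - {0 :: 'a}) \<subseteq> unit_circle q"
      unfolding unit_circle_def
    proof (intro image_subsetI CollectI)
      fix x :: 'a assume "x \<in> UNIV - {0}"
      then show "(x ^ (q - 1)) ^ (q + 1) = 1"
        unfolding power_mult[symmetric] by (intro power_pred_Suc_q) simp
    qed
    show "card {a \<in> UNIV - {0}. a ^ (q - 1) = b} \<le> q - 1" for b :: 'a
      using q_ge_2 by (intro order_trans[OF card_mono card_power_eq_le[of "q - 1" b]]) auto
  qed simp
  then have "0 < q - 1 \<longrightarrow> q + 1 \<le> card (unit_circle q :: 'a set)"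
    by (simp only: units_count mult_le_cancel1)
  then show "q + 1 \<le> card (unit_circle q :: 'a set)" using q_ge_2 by simp
qed

text \<open>The same argument with the norm x \<mapsto> x^(q+1), whose fibres have at most q + 1
  elements.\<close>

lemma card_F': "card F = q"
proof -
  have F0: "F - {0} = {x. x ^ (q - 1) = 1}"
  proof -
    obtain k where k: "q = Suc k" "k \<noteq> 0" using q_ge_2 by (cases q) auto
    show ?thesis by (auto simp: F_eq k power_0_left)
  qed
  have "card (F - {0}) \<le> q - 1" unfolding F0 using q_ge_2 by (intro card_power_eq_le) simp
  moreover have "card (UNIV - {0 :: 'a}) \<le> (q + 1) * card (F - {0})"
  proof (rule card_le_fibres[where f = "\<lambda>x. x ^ (q + 1)"])
    show "(\<lambda>x. x ^ (q + 1)) ` (UNIV - {0 :: 'a}) \<subseteq> F - {0}"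
      using power_q_q by (auto simp: F_eq power_mult_distrib)
    show "card {a \<in> UNIV - {0}. a ^ (q + 1) = b} \<le> q + 1" for b :: 'a
      by (intro order_trans[OF card_mono card_power_eq_le[of "q + 1" b]]) auto
  qed simp
  then have "q - 1 \<le> card (F - {0})"
    unfolding units_count by (metis add_gr_0 less_one mult.commute mult_le_cancel1)
  ultimately have "card (F - {0}) = q - 1" by simp
  moreover have "0 \<in> F" using is_subfield_F by (rule is_subfield_zero)
  ultimately show ?thesis using q_ge_2 by (simp add: card_Diff_singleton)
qed

sublocale binary_subfield F q
  by unfold_locales (simp_all add: is_subfield_F card_F' char_2')

section \<open>Traces of elements of the unit circle\<close>

abbreviation H :: "'a set" where "H \<equiv> unit_circle q"

lemma unit_circle_nonzero: "x \<in> H \<Longrightarrow> x \<noteq> 0"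
  by (auto simp: unit_circle_def)

lemma unit_circle_power_q: "x \<in> H \<Longrightarrow> x ^ q = inverse x"
  using unit_circle_nonzero[of x] by (simp add: unit_circle_def field_simps)

lemma unit_circle_one: "1 \<in> H"
  by (simp add: unit_circle_def)

lemma unit_circle_mult: "x \<in> H \<Longrightarrow> y \<in> H \<Longrightarrow> x * y \<in> H"
  by (simp add: unit_circle_def power_mult_distrib del: power_Suc)

lemma unit_circle_inverse: "x \<in> H \<Longrightarrow> inverse x \<in> H"
  by (simp add: unit_circle_def power_inverse del: power_Suc)

lemma unit_circle_trace_in_F: "x \<in> H \<Longrightarrow> x + inverse x \<in> F"
  by (simp add: F_eq power_q_add unit_circle_power_q power_inverse add.commute)

lemma add_eq_0_iff_eq: "x + y = 0 \<longleftrightarrow> x = (y :: 'a)"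
  by (metis add.right_neutral add_self add_self_left)

lemma unit_circle_trace_eq_0_iff: "x \<in> H \<Longrightarrow> x + inverse x = 0 \<longleftrightarrow> x = 1"
proof -
  assume "x \<in> H"
  then have "x + inverse x = 0 \<longleftrightarrow> x\<^sup>2 = 1\<^sup>2"
    using unit_circle_nonzero[of x] by (auto simp: add_eq_0_iff_eq power2_eq_square field_simps)
  then show ?thesis by (simp only: square_eq_iff)
qed

text \<open>If 1/t had trace zero, then X^2 + t X + 1, which has the root x, would split over F. But
  an element of H in F satisfies x^2 = 1 and so equals 1.\<close>

lemma unit_circle_trace_not_in_wp:
  assumes x: "x \<in> H" "x \<noteq> 1"
  shows "inverse (x + inverse x) \<notin> wp"
proof
  define t where "t = x + inverse x"
  have t: "t \<noteq> 0" "t \<in> F" using x unit_circle_trace_eq_0_iff unit_circle_trace_in_F by (auto simp: t_def)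
  assume "inverse (x + inverse x) \<in> wp"
  then have "(inverse t)\<^sup>2 \<in> wp"
    using square_in_wp_iff[of "inverse t"] t F by (simp add: t_def is_subfield_inverse)
  then obtain y where y: "y \<in> F" "(inverse t)\<^sup>2 = y\<^sup>2 + y" by (auto simp: wp_def)
  define z where "z = t * y"
  have zF: "z \<in> F" using t y F by (simp add: z_def is_subfield_mult)
  have "z\<^sup>2 + z * t = t\<^sup>2 * (y\<^sup>2 + y)" by (simp add: z_def algebra_simps power2_eq_square)
  also have "\<dots> = 1" using t by (simp add: y(2)[symmetric] flip: power_mult_distrib)
  finally have z: "z\<^sup>2 + z * t = 1" .
  have "x * t = x\<^sup>2 + 1" using unit_circle_nonzero[OF x(1)] by (simp add: t_def algebra_simps power2_eq_square)
  then have xt: "x\<^sup>2 + x * t = 1" by (simp add: add_self_left)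
  have "(x + z) * (x + z + t) = (x\<^sup>2 + x * t) + (z\<^sup>2 + z * t) + 2 * (x * z)"
    by (simp add: algebra_simps power2_eq_square)
  also have "\<dots> = 0" by (simp only: z xt two_eq_0 add_self) simp
  finally have "x = z \<or> x = z + t"
    by (simp add: add_eq_0_iff_eq add.assoc)
  then have "x \<in> F" using zF t F by (auto intro: is_subfield_add)
  then have "x\<^sup>2 = 1\<^sup>2" using x(1) by (simp add: F_eq unit_circle_def power2_eq_square)
  then show False using x(2) by (simp only: square_eq_iff)
qed

text \<open>The map x \<mapsto> 1/(x + 1/x) is at most two-to-one on the q elements of H - {1}, and
  its image lies in \<open>F - wp\<close>, which has q/2 elements; hence it is onto.\<close>

lemma exists_unit_circle_trace:
  assumes t: "t \<in> F" "t \<noteq> 0" "inverse t \<notin> wp"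
  shows "\<exists>x\<in>H. x + inverse x = t"
proof -
  let ?f = "\<lambda>x. inverse (x + inverse x)"
  have sub: "?f ` (H - {1}) \<subseteq> F - wp"
    using unit_circle_trace_not_in_wp unit_circle_trace_in_F F by (auto intro: is_subfield_inverse)
  have "card (H - {1}) \<le> 2 * card (?f ` (H - {1}))"
  proof (rule card_le_fibres[where f = ?f])
    fix b assume "b \<in> ?f ` (H - {1})"
    show "card {a \<in> H - {1}. ?f a = b} \<le> 2"
    proof -
      let ?p = "[:1, inverse b, 1:]"
      have "card {a \<in> H - {1}. ?f a = b} \<le> card {x. poly ?p x = 0}"
      proof (rule card_mono)
        show "{a \<in> H - {1}. ?f a = b} \<subseteq> {x. poly ?p x = 0}"
        proof
          fix a assume "a \<in> {a \<in> H - {1}. ?f a = b}"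
          then have a: "a \<in> H" "inverse b = a + inverse a" by auto
          have "a * inverse b = a\<^sup>2 + 1"
            using unit_circle_nonzero[OF a(1)] by (simp add: a(2) algebra_simps power2_eq_square)
          then have "poly ?p a = (a\<^sup>2 + 1) + (a\<^sup>2 + 1)"
            by (simp add: algebra_simps power2_eq_square)
          then show "a \<in> {x. poly ?p x = 0}" by (simp only: add_self mem_Collect_eq)
        qed
      qed simp
      also have "\<dots> \<le> degree ?p" by (rule card_poly_roots_bound) simp
      finally show ?thesis by simp
    qed
  qed auto
  moreover have "card (H - {1}) = q"
    using card_unit_circle unit_circle_one by (simp add: card_Diff_singleton)
  moreover have "card (F - wp) = q - card wp"
    using wp_subset finite_F card_F by (simp add: card_Diff_subset)
  ultimately have "card (F - wp) \<le> card (?f ` (H - {1}))" using card_wp by simp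
  then have "?f ` (H - {1}) = F - wp"
    using sub by (intro card_seteq) auto
  moreover have "inverse t \<in> F - wp" using t F by (simp add: is_subfield_inverse)
  ultimately have "inverse t \<in> ?f ` (H - {1})" by simp
  then obtain x where "x \<in> H" "inverse t = ?f x" by blast
  then show ?thesis by (auto simp: inverse_eq_iff_eq)
qed

section \<open>Sums of two and of three elements of the unit circle\<close>

lemma exists_sqrt: "x \<in> F \<Longrightarrow> \<exists>y\<in>F. y\<^sup>2 = x"
proof -
  assume x: "x \<in> F"
  have "(x ^ 2 ^ (e - 1))\<^sup>2 = x ^ q"
    using e_pos by (simp add: q_eq flip: power_mult power_Suc2)
  then show ?thesis using x F power_q[OF x] by (auto intro: is_subfield_power)
qed

text \<open>Conjugation x \<mapsto> x^q fixes r and inverts x. For r = 1 the term r^2 + 1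
  vanishes.\<close>

lemma norm_add:
  assumes "r \<in> F" "x \<in> H"
  shows "(r + x) ^ (q + 1) = r\<^sup>2 + 1 + r * (x + inverse x)"
proof -
  have "(r + x) ^ (q + 1) = (r + x) * (r + inverse x)"
    using assms by (simp add: power_q_add unit_circle_power_q power_q)
  then show ?thesis
    using unit_circle_nonzero[OF assms(2)] by (simp add: algebra_simps power2_eq_square)
qed

text \<open>
  For \<open>x \<in> H\<close> with \<open>t = x + 1/x\<close>, the element \<open>r + x\<close> has norm \<open>d + r t\<close>, \<open>d = (r + 1)\<^sup>2\<close>, and it is
  a sum \<open>z + z y\<close> of two elements of \<open>H\<close> as soon as \<open>1/(d + r t)\<close> has trace one. If \<open>x = 1\<close> does
  not work, the two sets of \<open>q/2\<close> values \<open>t\<close> for which \<open>1/t\<close>, respectively \<open>1/(d + r t)\<close>, has trace one both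
  avoid \<open>0\<close> and \<open>d/r\<close>, hence they intersect.
\<close>
lemma F_element_sum_three:
  assumes r: "r \<in> F" "r \<noteq> 0" "r \<noteq> 1"
  shows "\<exists>x\<in>H. \<exists>y\<in>H. \<exists>z\<in>H. r = x + y + z"
proof -
  define d where "d = (r + 1)\<^sup>2"
  have r1: "r + 1 \<noteq> 0" using r by (simp add: add_eq_0_iff_eq)
  have "d \<in> F" using r F by (auto simp: d_def intro!: is_subfield_closed)
  moreover have "d \<noteq> 0" using r1 by (simp add: d_def)
  moreover have "d = r\<^sup>2 + 1" unfolding d_def power2_add by simp
  ultimately have d: "d \<in> F" "d \<noteq> 0" "d = r\<^sup>2 + 1" by blast+
  have "\<exists>x\<in>H. d + r * (x + inverse x) \<noteq> 0 \<and> inverse (d + r * (x + inverse x)) \<notin> wp"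
  proof (cases "inverse d \<in> wp")
    case False
    then show ?thesis using d unit_circle_one by (intro bexI[of _ 1]) (simp_all add: two_eq_0)
  next
    case True
    define f where "f = (\<lambda>w. (inverse w + d) / r)"
    let ?A = "inverse ` (F - wp)" and ?B = "f ` (F - wp)"
    have cwp: "2 * card (F - wp) = q"
      using wp_subset finite_F card_F card_wp by (simp add: card_Diff_subset)
    have inj: "inj_on f (F - wp)" using r by (auto simp: inj_on_def f_def)
    have "0 \<notin> ?A" using wp_0 by auto
    moreover have "d / r \<notin> ?A"
    proof
      assume "d / r \<in> ?A"
      then obtain w where "w \<notin> wp" "inverse w = d / r" by auto
      then have "r / d \<notin> wp" by (metis inverse_divide inverse_inverse_eq)
      \<comment> \<open>In characteristic two r/d = r/(r + 1)^2 equals y^2 + y for y = 1/(r + 1), so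
        it has trace zero.\<close>
      moreover have "(inverse (r + 1))\<^sup>2 + inverse (r + 1) \<in> wp"
        unfolding wp_def using r F by (intro imageI is_subfield_inverse is_subfield_add is_subfield_one)
      moreover have "(inverse (r + 1))\<^sup>2 + inverse (r + 1) = (1 + (r + 1)) / (r + 1)\<^sup>2"
        using r1 by (simp add: divide_simps power2_eq_square)
      moreover have "1 + (r + 1) = r" using add_self_left[of 1 r] by (simp add: add_ac)
      ultimately show False by (simp add: d_def)
    qed
    moreover have "0 \<notin> ?B"
    proof
      assume "0 \<in> ?B"
      then obtain w where "w \<notin> wp" "inverse w = d" using r by (auto simp: f_def add_eq_0_iff_eq)
      then show False using True by auto
    qed
    moreover have "d / r \<notin> ?B"
    proof
      assume "d / r \<in> ?B"
      then obtain w where w: "w \<notin> wp" "d / r = (inverse w + d) / r" by (auto simp: f_def)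
      then show False using wp_0 r by auto
    qed
    moreover have "?A \<subseteq> F" "?B \<subseteq> F" using F r d by (auto simp: f_def intro!: is_subfield_closed)
    ultimately have sub: "?A \<union> ?B \<subseteq> F - {0, d / r}" by blast
    have "card (F - {0, d / r}) = q - 2"
      using F r d finite_F card_F by (subst card_Diff_subset) (auto intro!: is_subfield_closed)
    then have "card (?A \<union> ?B) < q"
      using card_mono[OF _ sub] finite_F q_ge_2 by simp
    moreover have "card ?A + card ?B = q"
      using cwp card_image[OF inj] card_image[of inverse "F - wp"] by (simp add: inj_on_def)
    moreover have "finite ?A" "finite ?B" using finite_F by auto
    ultimately have "?A \<inter> ?B \<noteq> {}" using card_Un_disjoint[of ?A ?B] by auto
    then obtain t w w' where w': "w' \<in> F - wp" "t = inverse w'" and w: "w \<in> F - wp" "t = f w"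
      by blast
    have t: "inverse t \<in> F - wp" using w' by simp
    have "t = (inverse w + d) / r" using w by (simp add: f_def)
    note w = w(1) this
    have "t \<in> F" "t \<noteq> 0" using t wp_0 is_subfield_inverse[OF F, of "inverse t"] by auto
    then obtain x where x: "x \<in> H" "x + inverse x = t" using exists_unit_circle_trace t by auto
    have "d + r * t = inverse w" using w r add_self_left[of d "inverse w"] by (simp add: add_ac)
    moreover have "w \<noteq> 0" using w wp_0 by auto
    ultimately show ?thesis using x w by (intro bexI[of _ x]) auto
  qed
  then obtain x where x: "x \<in> H" and ne: "d + r * (x + inverse x) \<noteq> 0"
    and nwp: "inverse (d + r * (x + inverse x)) \<notin> wp" by blast
  have "d + r * (x + inverse x) \<in> F"
    by (rule is_subfield_add[OF F d(1) is_subfield_mult[OF F r(1) unit_circle_trace_in_F[OF x]]])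
  then obtain y where y: "y \<in> H" "y + inverse y = d + r * (x + inverse x)"
    using exists_unit_circle_trace ne nwp by blast
  have nb: "(r + x) ^ (q + 1) = y + inverse y" using norm_add[OF r(1) x] d y by simp
  have n1: "(1 + y) ^ (q + 1) = y + inverse y"
    using norm_add[OF _ y(1), of 1] F by (simp add: is_subfield_one two_eq_0 flip: one_add_one)
  \<comment> \<open>Both r + x and 1 + y have norm y + 1/y, so their quotient lies in H.\<close>
  define z where "z = (r + x) / (1 + y)"
  have z: "z \<in> H" unfolding unit_circle_def z_def
    using nb n1 y ne by (simp add: power_divide del: power_Suc)
  have "1 + y \<noteq> 0" using n1 y ne by auto
  then have "z * (1 + y) = r + x" by (simp add: z_def)
  then have "r = x + (z + z * y)" using add_self_left[of x r] by (simp add: algebra_simps)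
  then show ?thesis using x y z unit_circle_mult[OF z y(1)] by (metis add.assoc)
qed

text \<open>If r \<in> F is the square root of the norm of a nonzero a, then a/r \<in> H, which
  reduces the claim to r. The cases a = 0 and r = 1 fall outside \<open>F_element_sum_three\<close>;
  the coefficients c and d let zero, one or three terms be present.\<close>

lemma sum_three_unit_circle:
  obtains c d x y z where "c \<in> {0,1}" "d \<in> {0,1}" "x \<in> H" "y \<in> H" "z \<in> H"
    "a = d * x + c * y + c * (z :: 'a)"
proof (cases "a = 0")
  case True
  then show ?thesis using that[of 0 0 1 1 1] unit_circle_one by simp
next
  case False
  have "a ^ (q + 1) \<in> F" using power_q_q by (simp add: F_eq power_mult_distrib)
  then obtain r where r: "r \<in> F" "r\<^sup>2 = a ^ (q + 1)" using exists_sqrt by blast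
  then have r0: "r \<noteq> 0" using False by auto
  have "r ^ (q + 1) = r\<^sup>2" using power_q[OF r(1)] by (simp add: power2_eq_square)
  then have h: "a / r \<in> H" using r False by (simp add: unit_circle_def power_divide del: power_Suc)
  show ?thesis
  proof (cases "r = 1")
    case True
    then show ?thesis using h that[of 0 1 "a / r" 1 1] unit_circle_one by simp
  next
    case False
    then obtain x y z where xyz: "x \<in> H" "y \<in> H" "z \<in> H" "r = x + y + z"
      using F_element_sum_three r(1) r0 by blast
    have "a = (a / r) * r" using r0 by simp
    also have "\<dots> = 1 * ((a / r) * x) + 1 * ((a / r) * y) + 1 * ((a / r) * z)"
      by (simp only: xyz(4) distrib_left mult_1)
    finally have "a = 1 * ((a / r) * x) + 1 * ((a / r) * y) + 1 * ((a / r) * z)" .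
    then show ?thesis
      by (rule that[rotated 5]) (simp_all add: unit_circle_mult h xyz(1-3) del: times_divide_eq_left)
  qed
qed

text \<open>The norm of such a combination gives (r + c1 + c2)^2 = c1 c2 t with t = x + 1/x and x =
  x1/x2, where r \<notin> K keeps both sides nonzero. So d/(r + c1 + c2) has square 1/t, which has
  trace one, against \<open>good\<close>.\<close>

lemma not_sum_two_unit_circle:
  assumes K: "is_subfield K" "K \<subseteq> F" and sqrt: "\<And>c. c \<in> K \<Longrightarrow> \<exists>d\<in>K. d\<^sup>2 = c"
    and r: "r \<in> F" "r \<notin> K"
    and good: "\<And>c1 c2 d. c1 \<in> K \<Longrightarrow> c2 \<in> K \<Longrightarrow> d \<in> K \<Longrightarrow> d\<^sup>2 = c1 * c2 \<Longrightarrow>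
      d / (r + (c1 + c2)) \<in> wp"
    and c: "c1 \<in> K" "c2 \<in> K" and x: "x1 \<in> H" "x2 \<in> H"
  shows "r \<noteq> c1 * x1 + c2 * x2"
proof
  assume eq: "r = c1 * x1 + c2 * x2"
  define x where "x = x1 * inverse x2"
  define t where "t = x + inverse x"
  have xH: "x \<in> H" using x by (simp add: x_def unit_circle_mult unit_circle_inverse)
  have tF: "t \<in> F" unfolding t_def by (rule unit_circle_trace_in_F[OF xH])
  note nz = unit_circle_nonzero[OF x(1)] unit_circle_nonzero[OF x(2)]
  have "c1 ^ q = c1" "c2 ^ q = c2" using power_q c K by auto
  then have "r ^ q = c1 * inverse x1 + c2 * inverse x2"
    unfolding eq using x by (simp add: power_q_add power_mult_distrib unit_circle_power_q)
  then have "r = c1 * inverse x1 + c2 * inverse x2" using power_q[OF r(1)] by simp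
  then have "r\<^sup>2 = (c1 * x1 + c2 * x2) * (c1 * inverse x1 + c2 * inverse x2)"
    unfolding power2_eq_square using eq by simp
  also have "\<dots> = c1\<^sup>2 + c2\<^sup>2 + c1 * c2 * t"
    using nz by (simp add: t_def x_def algebra_simps power2_eq_square)
  finally have rr: "r\<^sup>2 = c1\<^sup>2 + c2\<^sup>2 + c1 * c2 * t" .
  have r2: "(r + (c1 + c2))\<^sup>2 = c1 * c2 * t"
  proof -
    have "(r + (c1 + c2))\<^sup>2 = (c1\<^sup>2 + c2\<^sup>2) + r\<^sup>2" unfolding power2_add by simp
    also have "\<dots> = c1 * c2 * t" unfolding rr add.assoc[of "c1\<^sup>2 + c2\<^sup>2"] by (rule add_self_left)
    finally show ?thesis .
  qed
  have rc: "r + (c1 + c2) \<noteq> 0"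
    using r(2) c K by (auto simp: add_eq_0_iff_eq intro: is_subfield_add)
  then have t0: "t \<noteq> 0" and c0: "c1 * c2 \<noteq> 0" using r2 by auto
  have "x \<noteq> 1" using t0 unit_circle_trace_eq_0_iff[OF xH] by (auto simp: t_def)
  then have nwp: "inverse t \<notin> wp" unfolding t_def using xH by (intro unit_circle_trace_not_in_wp)
  obtain d where d: "d \<in> K" "d\<^sup>2 = c1 * c2" using sqrt[of "c1 * c2"] c K by (auto intro: is_subfield_mult)
  have "(d / (r + (c1 + c2)))\<^sup>2 = inverse t"
    unfolding power_divide r2 d(2) using c0 t0 by (simp add: field_simps)
  moreover have "d / (r + (c1 + c2)) \<in> F" using d c r K F by (auto intro!: is_subfield_closed)
  ultimately show False using square_in_wp_iff good[OF c d] nwp by metis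
qed

end

text \<open>The power 2^(n s div 2) is the factor v of q and may be as small as sqrt (q/2), while
  the hypothesis only yields P A < sqrt q with A = 8 p^2 - 14 p + 3. Rounding to powers of two
  closes the gap.\<close>

lemma numeric_bound:
  fixes n s p q0 :: nat
  assumes n: "n \<ge> 2" and q0: "q0 = 2 ^ n" and p: "p = 2 ^ (n - 1)" and s: "s \<ge> 3" "odd s"
    and hyp: "real q0 ^ s
           - real q0 powr (real s / 2) * (real q0 / 2) ^ (q0 - 1)
               * (2 * (real q0)\<^sup>2 - 7 * real q0 + 3)
         > (real q0 / 2) ^ (q0 - 1) * (4 * real q0 - 2) - (real q0)\<^sup>2"
  shows "8 * p ^ 2 * p ^ (2 * p - 1) \<le> 2 ^ (n * s div 2) \<or> p = 2 \<and> 128 \<le> (2::nat) ^ (n * s div 2)"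
proof -
  have q0p: "q0 = 2 * p" using n by (simp add: q0 p flip: power_Suc)
  have p2: "p \<ge> 2" using n power_increasing[of 1 "n - 1" "2 :: nat"] by (simp add: p)
  define P where "P = real p ^ (2 * p - 1)"
  define A where "A = 2 * (real q0)\<^sup>2 - 7 * real q0 + 3"
  define Q where "Q = real q0 ^ s"
  have Q: "Q = 2 ^ (n * s)" by (simp add: Q_def q0 power_mult)
  have Q0: "Q > 0" by (simp add: Q)
  have "real q0 powr (real s / 2) = (real q0 powr real s) powr (1/2)" by (simp add: powr_powr)
  also have "\<dots> = sqrt Q" using p2 by (simp add: Q_def powr_realpow powr_half_sqrt q0p)
  finally have sq: "real q0 powr (real s / 2) = sqrt Q" .
  have "real p ^ 1 \<le> P" unfolding P_def using p2 by (intro power_increasing) auto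
  then have Pp: "real p \<le> P" by simp
  have "4 * real p * real p \<le> P * (8 * real p - 2)"
  proof -
    have "real p * (4 * real p) \<le> P * (8 * real p - 2)"
      using Pp p2 by (intro mult_mono) auto
    then show ?thesis by (simp add: algebra_simps)
  qed
  then have "sqrt Q * P * A < Q"
    using hyp unfolding sq Q_def[symmetric] A_def[symmetric] by (simp add: q0p P_def power2_eq_square algebra_simps)
  then have "sqrt Q * (P * A) < sqrt Q * sqrt Q" using Q0 by (simp add: mult.assoc)
  then have PA: "P * A < sqrt Q" by (rule mult_left_less_imp_less) (use Q0 in simp)
  have Ap: "A = 8 * (real p)\<^sup>2 - 14 * real p + 3" by (simp add: A_def q0p power2_eq_square)
  have A0: "A \<ge> 0"
  proof -
    have "14 * real p \<le> 8 * (real p)\<^sup>2 + 3"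
    proof (cases "p = 2")
      case False
      then have "real p * 14 \<le> real p * (8 * real p)" using p2 by (intro mult_left_mono) auto
      then show ?thesis by (simp add: power2_eq_square)
    qed (simp add: power2_eq_square)
    then show ?thesis by (simp add: Ap)
  qed
  have P0: "P > 0" using p2 by (simp add: P_def)
  have PAQ: "(P * A)\<^sup>2 < Q"
  proof -
    have "(P * A)\<^sup>2 < (sqrt Q)\<^sup>2" using PA A0 P0 by (intro power_strict_mono) auto
    then show ?thesis using Q0 by simp
  qed
  consider "n = 2" | "n = 3" | "n \<ge> 4" using n by linarith
  then show ?thesis
  proof cases
    case 1
    then have pv: "p = 2" by (simp add: p)
    \<comment> \<open>Here P A = 56, and 56^2 > 2^11; oddness of s then excludes s = 6.\<close>
    have "(2::real) ^ 11 < 2 ^ (n * s)"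
      using PAQ by (simp add: P_def Ap pv Q)
    then have "11 < n * s" by (rule power_less_imp_less_exp[rotated]) simp
    then have "s \<ge> 6" using 1 by simp
    then have "s \<ge> 7" using s(2) by (cases "s = 6") auto
    then have "(2::nat) ^ 7 \<le> 2 ^ s" by (intro power_increasing) auto
    then show ?thesis using pv 1 by simp
  next
    case 2
    then have pv: "p = 4" by (simp add: p)
    \<comment> \<open>Here P = 2^14 and A = 75, and 75^2 > 2^12.\<close>
    have "(2::real) ^ 40 < 2 ^ (n * s)"
      using PAQ by (simp add: P_def Ap pv Q)
    then have "40 < n * s" by (rule power_less_imp_less_exp[rotated]) simp
    then have "s \<ge> 14" using 2 by simp
    then have "s \<ge> 15" using s(2) by (cases "s = 14") auto
    then have "(2::nat) ^ 22 \<le> 2 ^ (n * s div 2)" using 2 by (intro power_increasing) auto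
    then show ?thesis by (simp add: pv)
  next
    case 3
    define j where "j = 2 + (n - 1) * (2 * p + 1)"
    have j: "4 * p ^ 2 * p ^ (2 * p - 1) = 2 ^ j"
    proof -
      have "4 * p ^ 2 * p ^ (2 * p - 1) = 2 ^ 2 * p ^ (2 * p + 1)"
        using p2 by (simp flip: power_add)
      then show ?thesis by (simp add: j_def p power_add power_mult)
    qed
    have rj: "4 * (real p)\<^sup>2 * P = 2 ^ j"
    proof -
      have "real (4 * p ^ 2 * p ^ (2 * p - 1)) = real (2 ^ j)" by (simp only: j)
      then show ?thesis by (simp add: P_def)
    qed
    have "2 ^ 3 \<le> p" unfolding p using 3 by (intro power_increasing) auto
    then have "real p * 14 \<le> real p * (2 * real p)" by (intro mult_left_mono) auto
    \<comment> \<open>This holds for p \<ge> 8 but fails for p = 2 and p = 4, hence the separate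
      cases.\<close>
    then have "6 * (real p)\<^sup>2 \<le> A" by (simp add: Ap power2_eq_square)
    then have "P * (6 * (real p)\<^sup>2) \<le> P * A" using P0 by (intro mult_left_mono) auto
    then have "(P * (6 * (real p)\<^sup>2))\<^sup>2 \<le> (P * A)\<^sup>2" by (intro power_mono) (use P0 in auto)
    then have "(P * (6 * (real p)\<^sup>2))\<^sup>2 < Q" using PAQ by simp
    moreover have "(P * (6 * (real p)\<^sup>2))\<^sup>2 = 9 / 4 * (4 * (real p)\<^sup>2 * P)\<^sup>2"
      by (simp add: power2_eq_square)
    \<comment> \<open>Since 9/4 > 2, one gets 2^(2j+1) < q strictly. This forces n s \<ge> 2j + 2
      and thus v \<ge> 2^(j+1) = 8 p^2 P.\<close>
    moreover have "2 * (4 * (real p)\<^sup>2 * P)\<^sup>2 \<le> 9 / 4 * (4 * (real p)\<^sup>2 * P)\<^sup>2" by simp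
    ultimately have "2 * (2 ^ j)\<^sup>2 < Q" unfolding rj by linarith
    moreover have "2 * (2 ^ j)\<^sup>2 = (2 :: real) ^ (2 * j + 1)" by (simp add: power_mult[symmetric] mult.commute)
    ultimately have "(2 :: real) ^ (2 * j + 1) < 2 ^ (n * s)" by (simp only: Q)
    then have "2 * j + 1 < n * s" by (rule power_less_imp_less_exp[rotated]) simp
    then have "j + 1 \<le> n * s div 2" by linarith
    then have "(2 :: nat) ^ (j + 1) \<le> 2 ^ (n * s div 2)" by (intro power_increasing) auto
    then show ?thesis using j by simp
  qed
qed

section \<open>A syndrome that needs more than two positions\<close>

context binary_quadratic_extension
begin

text \<open>For q0 = 2 the only nontrivial condition is that 1/r has trace zero, and r is found
  directly. Otherwise the exponent of q is halved, so that u is v or 2 v.\<close>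

lemma exists_not_sum_two:
  fixes q0 n s :: nat and K :: "'a set"
  assumes q0: "q0 = 2 ^ n" "n > 0" and q: "q = q0 ^ s" and s: "s \<ge> 3" "odd s"
    and K: "is_subfield K" "card K = q0"
    and hyp: "real q0 ^ s
           - real q0 powr (real s / 2) * (real q0 / 2) ^ (q0 - 1)
               * (2 * (real q0)\<^sup>2 - 7 * real q0 + 3)
         > (real q0 / 2) ^ (q0 - 1) * (4 * real q0 - 2) - (real q0)\<^sup>2"
  shows "\<exists>r. \<forall>c1\<in>K. \<forall>c2\<in>K. \<forall>x1\<in>H. \<forall>x2\<in>H. r \<noteq> c1 * x1 + c2 * x2"
proof -
  define p :: nat where "p = 2 ^ (n - 1)"
  have q0p: "q0 = 2 * p" using q0 by (simp add: p_def flip: power_Suc)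
  interpret K: binary_subfield K q0
    by unfold_locales (use K char_2 in auto)
  have KF: "K \<subseteq> F"
  proof
    fix x assume "x \<in> K"
    have "x ^ q0 ^ i = x" for i
      by (induction i) (use K.power_q[OF \<open>x \<in> K\<close>] in \<open>simp_all add: power_mult\<close>)
    then show "x \<in> F" by (simp add: F_eq q)
  qed
  have K0: "0 \<in> K" and K1: "1 \<in> K" using K by (auto intro: is_subfield_closed)
  \<comment> \<open>\<open>D \<gamma>\<close> consists of the square roots of the products \<open>c\<^sub>1 c\<^sub>2\<close> with \<open>c\<^sub>1 + c\<^sub>2 = \<gamma>\<close>.\<close>
  define D where "D = (\<lambda>\<gamma>. if \<gamma> = 0 then K else (*) \<gamma> ` K.wp)"
  have D0: "0 \<in> D \<gamma>" for \<gamma> using K0 K.wp_0 by (auto simp: D_def intro: image_eqI[of _ _ 0])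
  have DK: "D \<gamma> \<subseteq> K" if "\<gamma> \<in> K" for \<gamma>
    using that K.wp_subset K(1) by (auto simp: D_def intro: is_subfield_mult)
  have Dadd: "a + b \<in> D \<gamma>" if "\<gamma> \<in> K" "a \<in> D \<gamma>" "b \<in> D \<gamma>" for \<gamma> a b
    using that K(1) K.wp_add
    by (auto simp: D_def is_subfield_add simp flip: distrib_left split: if_splits)
  have cardD: "card (D 0) = 2 * p" "\<And>\<gamma>. \<gamma> \<noteq> 0 \<Longrightarrow> card (D \<gamma>) = p"
    using K(2) K.card_wp by (auto simp: D_def q0p card_image inj_on_def)
  have "\<exists>r\<in>F - K. \<forall>\<gamma>\<in>K. \<forall>d\<in>D \<gamma>. \<chi> (d / (r + \<gamma>)) = 1"
  proof (cases "n = 1")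
    case True
    then have q02: "q0 = 2" by (simp add: q0)
    have K01: "K = {0, 1}"
      using K0 K1 K(2) by (intro card_seteq[symmetric]) (auto simp: q02)
    have "K.wp \<subseteq> {0}"
    proof
      fix x assume "x \<in> K.wp"
      then obtain y where "y \<in> K" "x = y\<^sup>2 + y" unfolding K.wp_def by blast
      then show "x \<in> {0}" using K01 two_eq_0 by auto
    qed
    have DK0: "D 0 = K" by (simp add: D_def)
    from \<open>K.wp \<subseteq> {0}\<close> have D1: "D 1 = {0}" using K.wp_0 by (auto simp: D_def)
    \<comment> \<open>So \<open>wp\<close> has at least 4 elements and contains one other than 0 and
      1; its inverse serves as r.\<close>
    have "(2::nat) ^ 3 \<le> q" unfolding q q02 using s by (intro power_increasing) auto
    then have "card {0 :: 'a, 1} < card wp" using card_wp by simp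
    then have "\<not> wp \<subseteq> {0, 1}" by (metis card_mono finite.emptyI finite.insertI not_le)
    then obtain w where w: "w \<in> wp" "w \<noteq> 0" "w \<noteq> 1" by blast
    have "inverse w \<in> F - K" using w wp_subset F by (auto simp: K01 intro: is_subfield_inverse)
    moreover have "\<chi> (d / (inverse w + \<gamma>)) = 1" if "\<gamma> \<in> K" "d \<in> D \<gamma>" for \<gamma> d
    proof (cases "\<gamma> = 0")
      case True
      then have "d = 0 \<or> d = 1" using that(2) DK0 K01 by blast
      then show ?thesis using True w(1) wp_0 by (auto simp: \<chi>_def divide_inverse)
    next
      case False
      then have "\<gamma> = 1" using that(1) K01 by blast
      then have "d = 0" using that(2) D1 by blast
      then show ?thesis by (simp add: chi_0)
    qed
    ultimately show ?thesis by blast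
  next
    case False
    then have n: "n \<ge> 2" using q0 by simp
    have p2: "p \<ge> 2" using n power_increasing[of 1 "n - 1" "2 :: nat"] by (simp add: p_def)
    let ?k = "n * s div 2"
    have "q = 2 ^ (n * s)" by (simp add: q q0 power_mult)
    also have "n * s = (n * s - ?k) + ?k" by simp
    finally have quv: "q = 2 ^ (n * s - ?k) * 2 ^ ?k" by (simp only: power_add)
    show ?thesis
    proof (rule exists_good_element[OF quv refl refl _ K(1) KF _ p2])
      show "(2::nat) ^ ?k \<le> 2 ^ (n * s - ?k)" by (intro power_increasing) auto
      show "8 * p\<^sup>2 * p ^ (2 * p - 1) \<le> 2 ^ ?k \<or> p = 2 \<and> 128 \<le> (2::nat) ^ ?k"
        by (rule numeric_bound[OF n q0(1) p_def s hyp])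
    qed (use DK KF D0 Dadd cardD K(2) q0p in auto)
  qed
  then obtain r where r: "r \<in> F" "r \<notin> K" and good: "\<And>\<gamma> d. \<gamma> \<in> K \<Longrightarrow> d \<in> D \<gamma> \<Longrightarrow> \<chi> (d / (r + \<gamma>)) = 1"
    by blast
  have sqrt: "\<exists>d\<in>K. d\<^sup>2 = c" if "c \<in> K" for c
  proof
    show "c ^ p \<in> K" using that K(1) by (intro is_subfield_power)
    show "(c ^ p)\<^sup>2 = c" using K.power_q[OF that] by (simp add: q0p mult.commute flip: power_mult)
  qed
  have "d / (r + (c1 + c2)) \<in> wp" if c: "c1 \<in> K" "c2 \<in> K" and d: "d \<in> K" "d\<^sup>2 = c1 * c2" for c1 c2 d
  proof -
    define \<gamma> where "\<gamma> = c1 + c2"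
    have \<gamma>K: "\<gamma> \<in> K" using c K(1) by (simp add: \<gamma>_def is_subfield_add)
    have "d \<in> D \<gamma>"
    proof (cases "\<gamma> = 0")
      case True
      then show ?thesis using d by (simp add: D_def)
    next
      case False
      \<comment> \<open>Hence c1 c2 is \<gamma>^2 times an element of \<open>K.wp\<close>, and
        square roots preserve membership in \<open>K.wp\<close>.\<close>
      have "c2 = c1 + \<gamma>" by (simp add: \<gamma>_def add_self_left)
      then have "(d / \<gamma>)\<^sup>2 = (c1 / \<gamma>)\<^sup>2 + c1 / \<gamma>"
        using False by (simp add: power_divide d divide_simps) (simp add: algebra_simps power2_eq_square)
      also have "\<dots> \<in> K.wp"
        unfolding K.wp_def using c \<gamma>K K(1) by (intro imageI is_subfield_divide)
      finally have "d / \<gamma> \<in> K.wp"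
        using K.square_in_wp_iff[of "d / \<gamma>"] d \<gamma>K K(1) by (simp add: is_subfield_divide)
      then show ?thesis using False by (auto simp: D_def intro!: image_eqI[of _ _ "d / \<gamma>"])
    qed
    then have "\<chi> (d / (r + \<gamma>)) = 1" using good \<gamma>K by blast
    then show ?thesis by (simp add: \<chi>_def \<gamma>_def split: if_splits)
  qed
  then show ?thesis
    using not_sum_two_unit_circle[OF K(1) KF sqrt r] by blast
qed

end

section \<open>The covering radius\<close>

lemma sum_indicator_mult:
  fixes c :: "'a::comm_ring_1"
  assumes "finite I" "y \<in> I"
  shows "(\<Sum>x\<in>I. (if x = y then c else 0) * x) = c * y"
  using assms by (simp add: if_distrib[of "\<lambda>t. t * _"] cong: if_cong)

lemma covering_radius_eqI:
  assumes "finite I" "finite A" "C \<subseteq> I \<rightarrow>\<^sub>E A" "C \<noteq> {}"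
    and upper: "\<And>u. u \<in> I \<rightarrow>\<^sub>E A \<Longrightarrow> \<exists>c\<in>C. hamming_dist I u c \<le> n"
    and lower: "\<exists>u\<in>I \<rightarrow>\<^sub>E A. \<forall>c\<in>C. n \<le> hamming_dist I u c"
  shows "covering_radius I A C = n"
proof -
  have finW: "finite (I \<rightarrow>\<^sub>E A)" using assms(1,2) by (intro finite_PiE) auto
  then have finC: "finite C" using assms(3) finite_subset by blast
  let ?m = "\<lambda>u. Min ((\<lambda>c. hamming_dist I u c) ` C)"
  have le: "?m u \<le> n" if "u \<in> I \<rightarrow>\<^sub>E A" for u
    using upper[OF that] finC by (auto intro: Min.coboundedI order_trans)
  obtain u where u: "u \<in> I \<rightarrow>\<^sub>E A" "\<forall>c\<in>C. n \<le> hamming_dist I u c" using lower by blast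
  then have "?m u = n" using le[OF u(1)] finC assms(4) by (intro antisym) auto
  then show ?thesis
    unfolding covering_radius_def using finW u(1) le by (intro Max_eqI) auto
qed

theorem theoremx4:
  fixes q0 s :: nat and K :: "'a::{field, finite} set"
  assumes "primepow q0" and "even q0"
    and "CARD('a) = (q0 ^ s)\<^sup>2"
    and "is_subfield K" and "card K = q0"
    and "s \<ge> 3" and "odd s"
    and "real q0 ^ s
           - real q0 powr (real s / 2) * (real q0 / 2) ^ (q0 - 1)
               * (2 * (real q0)\<^sup>2 - 7 * real q0 + 3)
         > (real q0 / 2) ^ (q0 - 1) * (4 * real q0 - 2) - (real q0)\<^sup>2"
  shows "covering_radius (unit_circle (q0 ^ s)) K (zetterberg_code s K) = 3"
proof -
  obtain p n where pn: "prime p" "n > 0" "q0 = p ^ n"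
    using assms(1) by (auto simp: primepow_def)
  then have "p = 2" using assms(2) by (metis even_power primes_dvd_imp_eq two_is_prime_nat)
  then have q0: "q0 = 2 ^ n" using pn by simp
  have q: "q0 ^ s = 2 ^ (n * s)" by (simp add: q0 power_mult)
  have "n * s > 0" using pn assms(6) by simp
  interpret binary_quadratic_extension "q0 ^ s" "n * s" "{x :: 'a. x ^ q0 ^ s = x}"
    by unfold_locales (use assms q \<open>n * s > 0\<close> in auto)
  let ?H = "unit_circle (q0 ^ s) :: 'a set" and ?C = "zetterberg_code s K"
  note K = assms(4)
  have C: "?C = {c \<in> ?H \<rightarrow>\<^sub>E K. (\<Sum>x\<in>?H. c x * x) = 0}"
    by (simp add: zetterberg_code_def assms(5) Let_def)
  \<comment> \<open>The indicators are added, so x1, x2, x3 need not be distinct; a coincidence only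
    lowers the weight.\<close>
  define word where "word = (\<lambda>c1 c2 c3 x1 x2 x3. \<lambda>x\<in>?H.
    (if x = x1 then c1 else 0) + (if x = x2 then c2 else 0) + (if x = x3 then c3 else (0::'a)))"
  have word_in: "word c1 c2 c3 x1 x2 x3 \<in> ?H \<rightarrow>\<^sub>E K" if "c1 \<in> K" "c2 \<in> K" "c3 \<in> K"
    for c1 c2 c3 x1 x2 x3
    using that K by (auto simp: word_def intro!: is_subfield_closed)
  have word_sum: "(\<Sum>x\<in>?H. word c1 c2 c3 x1 x2 x3 x * x) = c1 * x1 + c2 * x2 + c3 * x3"
    if "x1 \<in> ?H" "x2 \<in> ?H" "x3 \<in> ?H" for c1 c2 c3 x1 x2 x3
    using that by (simp add: word_def distrib_right sum.distrib sum_indicator_mult)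
  have word: "\<exists>c1\<in>K. \<exists>c2\<in>K. \<exists>c3\<in>K. \<exists>x1\<in>?H. \<exists>x2\<in>?H. \<exists>x3\<in>?H.
      (\<Sum>x\<in>?H. word c1 c2 c3 x1 x2 x3 x * x) = a" for a
  proof -
    obtain c d x y z where "c \<in> {0,1}" "d \<in> {0,1}" "x \<in> ?H" "y \<in> ?H" "z \<in> ?H"
      "a = d * x + c * y + c * z" by (rule sum_three_unit_circle)
    moreover have "c \<in> K" "d \<in> K" using calculation K by (auto intro: is_subfield_closed)
    ultimately show ?thesis using word_sum by blast
  qed
  show ?thesis
  proof (rule covering_radius_eqI)
    show "?C \<subseteq> ?H \<rightarrow>\<^sub>E K" by (auto simp: C)
    have "(\<lambda>x\<in>?H. 0) \<in> ?C" using K by (auto simp: C is_subfield_zero)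
    then show "?C \<noteq> {}" by blast
  next
    fix u assume u: "u \<in> ?H \<rightarrow>\<^sub>E K"
    obtain c1 c2 c3 x1 x2 x3 where c: "c1 \<in> K" "c2 \<in> K" "c3 \<in> K" "x1 \<in> ?H" "x2 \<in> ?H" "x3 \<in> ?H"
      and sum: "(\<Sum>x\<in>?H. word c1 c2 c3 x1 x2 x3 x * x) = (\<Sum>x\<in>?H. u x * x)"
      using word by blast
    define w where "w = word c1 c2 c3 x1 x2 x3"
    have w: "w \<in> ?H \<rightarrow>\<^sub>E K" using word_in c by (simp add: w_def)
    define c where "c = (\<lambda>x\<in>?H. u x - w x)"
    have "(\<Sum>x\<in>?H. c x * x) = (\<Sum>x\<in>?H. u x * x) - (\<Sum>x\<in>?H. w x * x)"
      by (simp add: c_def left_diff_distrib sum_subtractf)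
    then have "c \<in> ?C" using u w K sum by (auto simp: C c_def w_def[symmetric] intro!: is_subfield_diff)
    moreover have "hamming_dist ?H u c \<le> 3"
    proof -
      have "{x \<in> ?H. u x \<noteq> c x} \<subseteq> {x1, x2, x3}" by (auto simp: c_def w_def word_def split: if_splits)
      then have "hamming_dist ?H u c \<le> card {x1, x2, x3}"
        unfolding hamming_dist_def by (intro card_mono) auto
      also have "\<dots> \<le> 3" by (simp add: card_insert_if)
      finally show ?thesis .
    qed
    ultimately show "\<exists>c\<in>?C. hamming_dist ?H u c \<le> 3" by blast
  next
    obtain r where r: "\<And>c1 c2 x1 x2. c1 \<in> K \<Longrightarrow> c2 \<in> K \<Longrightarrow> x1 \<in> ?H \<Longrightarrow> x2 \<in> ?H \<Longrightarrow>
        r \<noteq> c1 * x1 + c2 * x2"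
      using exists_not_sum_two[OF q0 pn(2) refl assms(6,7) K assms(5,8)] by blast
    obtain u where u: "u \<in> ?H \<rightarrow>\<^sub>E K" "(\<Sum>x\<in>?H. u x * x) = r"
      using word[of r] word_in by blast
    have "3 \<le> hamming_dist ?H u c" if c: "c \<in> ?C" for c
    proof (rule ccontr)
      define W where "W = {x \<in> ?H. u x \<noteq> c x}"
      assume "\<not> 3 \<le> hamming_dist ?H u c"
      then have cW: "card W \<le> 2" by (simp add: hamming_dist_def W_def)
      have WH: "W \<subseteq> ?H" by (auto simp: W_def)
      have cK: "c \<in> ?H \<rightarrow>\<^sub>E K" "(\<Sum>x\<in>?H. c x * x) = 0" using c by (auto simp: C)
      have dK: "u x - c x \<in> K" if "x \<in> ?H" for x
        using that u cK K by (auto intro!: is_subfield_diff)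
      have "r = (\<Sum>x\<in>?H. (u x - c x) * x)"
        using u cK by (simp add: left_diff_distrib sum_subtractf)
      also have "\<dots> = (\<Sum>x\<in>W. (u x - c x) * x)"
        by (rule sum.mono_neutral_right) (auto simp: W_def)
      finally have rW: "r = (\<Sum>x\<in>W. (u x - c x) * x)" .
      \<comment> \<open>Fewer than two positions are padded with zero coefficients, at the point 1
        or at x itself.\<close>
      consider "W = {}" | x where "W = {x}" | x y where "W = {x, y}" "x \<noteq> y"
        using cW by (auto simp: le_Suc_eq numeral_2_eq_2 card_Suc_eq card_0_eq)
      then show False
      proof cases
        case 1
        then show False using rW r[of 0 0 1 1] K unit_circle_one by (simp add: is_subfield_zero)
      next
        case (2 x)
        then show False
          using rW r[of "u x - c x" 0 x x] dK[of x] WH K by (simp add: is_subfield_zero)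
      next
        case (3 x y)
        then show False
          using rW r[of "u x - c x" "u y - c y" x y] dK[of x] dK[of y] WH by simp
      qed
    qed
    then show "\<exists>u\<in>?H \<rightarrow>\<^sub>E K. \<forall>c\<in>?C. 3 \<le> hamming_dist ?H u c" using u(1) by blast
  qed simp_all
qed

end
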